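(* Let $A$ be a coherent $PF$-quantale. The following are equivalent: (1) $A$ is a $PP$-quantale; (2) the reticulation $L(A)$ is a Stone lattice; (3) the inclusion $\mathrm{Min}_{Id,Z}(L(A))\subseteq \mathrm{Spec}_{Id,Z}(L(A))$ has a continuous retraction; (4) the inclusion $\mathrm{Min}_Z(A)\subseteq \mathrm{Spec}_Z(A)$ has a continuous retraction; (5) for every $c\in K(A)$, $\mathrm{Min}(A)\cap D(c)$ is an open subset of $\mathrm{Spec}_Z(\mathrm{Vir}(A))$; (6) $\mathrm{Min}_Z(A)$ is a compact space.
   Context: A quantale is a complete lattice $(A,\vee,\wedge,0,1)$ with an associative multiplication distributing over arbitrary joins in each variable. All quantales are assumed commutative and integral ($1$ is the multiplicative unit). $K(A)$ is the set of compact elements. $A$ is algebraic if every element is a join of compact elements; $A$ is coherent if it is algebraic, $1\in K(A)$ and $K(A)$ is closed under multiplication. $a^{\perp}=\bigvee\{x\in A: ax=0\}$. $B(A)$ is the set of complemented elements (those $e$ with $e\vee e^{\perp}=1$). An element $p<1$ is $m$-prime if $ab\le p$ implies $a\le p$ or $b\le p$; $\mathrm{Spec}(A)$ is the set of $m$-prime elements and $\mathrm{Min}(A)$ the set of minimal ones. $D(a)=\{p\in\mathrm{Spec}(A): a\not\le p\}$. $\mathrm{Spec}_Z(A)$ is $\mathrm{Spec}(A)$ with open sets $D(a)$, $a\in A$, and $\mathrm{Min}_Z(A)$ is $\mathrm{Min}(A)$ with the subspace topology. For a bounded distributive lattice $L$, $\mathrm{Spec}_{Id,Z}(L)$ is the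 set of prime ideals of $L$ with the Stone topology (basic open sets $\{P: x\notin P\}$, $x\in L$), and $\mathrm{Min}_{Id,Z}(L)$ is its subspace of minimal prime ideals. An element $a$ is pure if for all $c\in K(A)$, $c\le a$ implies $a\vee c^{\perp}=1$; the set $\mathrm{Vir}(A)$ of pure elements is a frame with the joins and finite meets of $A$. $\mathrm{Spec}_Z(\mathrm{Vir}(A))$ is the set of prime elements of this frame, with open sets $\{p: a\not\le p\}$, $a\in \mathrm{Vir}(A)$. For a coherent $PF$-quantale $A$ one has $\mathrm{Min}(A)=\mathrm{Spec}(\mathrm{Vir}(A))$ as subsets of $A$, so that (5) makes sense. $A$ is a $PF$-quantale if $c^{\perp}$ is pure for all $c\in K(A)$, and a $PP$-quantale if $c^{\perp}\in B(A)$ for all $c\in K(A)$. A bounded distributive lattice $L$ is a Stone lattice if for every $x\in L$ there is a complemented $e\in L$ with $\{y: x\wedge y=0\}=\{y: y\le e\}$. The reticulation of a coherent quantale $A$ is the (unique up to isomorphism) bounded distributive lattice $L(A)$ together with a surjective map $\lambda_A:K(A)\to L(A)$ such that for all $a,b\in K(A)$: $\lambda_A(a\vee b)\le\lambda_A(a)\vee\lambda_A(b)$; $\lambda_A(ab)=\lambda_A(a)\wedge\lambda_A(b)$; $\lambda_A(a)\le\lambda_A(b)$ iff $a^n\le b$ for some integer $n\ge1$. *)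

theory Defs
  imports "HOL-Analysis.Abstract_Topology_2"
begin

section \<open>Coherent quantales\<close>

text \<open>
  Quantales are commutative and integral. The bottom element is \<open>bot\<close>; the top element is the
  multiplicative unit \<open>1\<close>. The trivial quantale, with \<open>bot = 1\<close>, is not excluded.
\<close>

class quantale = complete_lattice + comm_monoid_mult +
  assumes top_eq_one: "top = 1"
    and mult_Sup: "x * Sup S = Sup ((*) x ` S)"

definition (in complete_lattice) compact_element :: "'a \<Rightarrow> bool" where
  "compact_element c \<longleftrightarrow> (\<forall>S. c \<le> Sup S \<longrightarrow> (\<exists>F. finite F \<and> F \<subseteq> S \<and> c \<le> Sup F))"

class coherent_quantale = quantale +
  assumes algebraic: "\<exists>C. (\<forall>c\<in>C. compact_element c) \<and> x = Sup C"
    and compact_one: "compact_element 1"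
    and compact_mult: "compact_element c \<Longrightarrow> compact_element d \<Longrightarrow> compact_element (c * d)"

definition perp :: "'a::quantale \<Rightarrow> 'a" where
  "perp a = Sup {x. a * x = bot}"

definition complemented_elements :: "'a::quantale set" where
  "complemented_elements = {e. sup e (perp e) = 1}"

definition pure_elements :: "'a::quantale set" where
  "pure_elements = {a. \<forall>c. compact_element c \<longrightarrow> c \<le> a \<longrightarrow> sup a (perp c) = 1}"

definition pf_quantale :: "'a::quantale itself \<Rightarrow> bool" where
  "pf_quantale _ \<longleftrightarrow> (\<forall>c::'a. compact_element c \<longrightarrow> perp c \<in> pure_elements)"

definition pp_quantale :: "'a::quantale itself \<Rightarrow> bool" where
  "pp_quantale _ \<longleftrightarrow> (\<forall>c::'a. compact_element c \<longrightarrow> perp c \<in> complemented_elements)"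


section \<open>Spectra of a quantale\<close>

definition spec :: "'a::quantale set" where
  "spec = {p. p < 1 \<and> (\<forall>a b. a * b \<le> p \<longrightarrow> a \<le> p \<or> b \<le> p)}"

definition min_spec :: "'a::quantale set" where
  "min_spec = {p \<in> spec. \<forall>q\<in>spec. q \<le> p \<longrightarrow> q = p}"

definition spec_basic :: "'a::quantale \<Rightarrow> 'a set" where
  "spec_basic a = {p \<in> spec. \<not> a \<le> p}"

definition spec_Z :: "'a::quantale topology" where
  "spec_Z = topology (\<lambda>U. \<exists>a. U = spec_basic a)"

definition min_Z :: "'a::quantale topology" where
  "min_Z = subtopology spec_Z min_spec"

text \<open>
  Binary meets in the frame of pure elements are those of the quantale, so primality in that frame
  is expressed with \<open>inf\<close>, not with the multiplication.
\<close>

definition vir_spec :: "'a::quantale set" where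
  "vir_spec = {p \<in> pure_elements. p < 1 \<and>
     (\<forall>a\<in>pure_elements. \<forall>b\<in>pure_elements. inf a b \<le> p \<longrightarrow> a \<le> p \<or> b \<le> p)}"

definition vir_spec_Z :: "'a::quantale topology" where
  "vir_spec_Z = topology (\<lambda>U. \<exists>a\<in>pure_elements. U = {p \<in> vir_spec. \<not> a \<le> p})"


section \<open>Bounded distributive lattices\<close>

definition stone_lattice :: "'l::{distrib_lattice,bounded_lattice} itself \<Rightarrow> bool" where
  "stone_lattice _ \<longleftrightarrow>
     (\<forall>x::'l. \<exists>e. (\<exists>f. sup e f = top \<and> inf e f = bot) \<and> {y. inf x y = bot} = {y. y \<le> e})"

definition lattice_ideal :: "'l::{distrib_lattice,bounded_lattice} set \<Rightarrow> bool" where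
  "lattice_ideal I \<longleftrightarrow>
     bot \<in> I \<and> (\<forall>x\<in>I. \<forall>y\<in>I. sup x y \<in> I) \<and> (\<forall>x\<in>I. \<forall>y. y \<le> x \<longrightarrow> y \<in> I)"

definition prime_ideals :: "'l::{distrib_lattice,bounded_lattice} set set" where
  "prime_ideals =
     {P. lattice_ideal P \<and> P \<noteq> UNIV \<and> (\<forall>x y. inf x y \<in> P \<longrightarrow> x \<in> P \<or> y \<in> P)}"

definition min_prime_ideals :: "'l::{distrib_lattice,bounded_lattice} set set" where
  "min_prime_ideals = {P \<in> prime_ideals. \<forall>Q\<in>prime_ideals. Q \<subseteq> P \<longrightarrow> Q = P}"

definition spec_Id_Z :: "'l::{distrib_lattice,bounded_lattice} set topology" where
  "spec_Id_Z = topology (arbitrary union_of (\<lambda>U. \<exists>x. U = {P \<in> prime_ideals. x \<notin> P}))"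


section \<open>Reticulations\<close>

text \<open>Only the values of \<open>lam\<close> at compact elements matter.\<close>

definition is_reticulation ::
  "('a::coherent_quantale \<Rightarrow> 'l::{distrib_lattice,bounded_lattice}) \<Rightarrow> bool" where
  "is_reticulation lam \<longleftrightarrow>
     lam ` {c. compact_element c} = UNIV \<and>
     (\<forall>a b. compact_element a \<longrightarrow> compact_element b \<longrightarrow>
        lam (sup a b) \<le> sup (lam a) (lam b) \<and>
        lam (a * b) = inf (lam a) (lam b) \<and>
        (lam a \<le> lam b \<longleftrightarrow> (\<exists>n\<ge>1. a ^ n \<le> b)))"


section \<open>The topologies are well defined\<close>

lemma mult_sup_quantale: "x * sup a b = sup (x * a) (x * (b::'a::quantale))"
  using mult_Sup[of x "{a, b}"] by simp

lemma mult_mono_quantale: "a \<le> b \<Longrightarrow> x * a \<le> x * (b::'a::quantale)"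
  by (metis mult_sup_quantale sup.absorb_iff2 sup.order_iff)

lemma mult_mono2_quantale: "a \<le> b \<Longrightarrow> c \<le> d \<Longrightarrow> a * c \<le> b * (d::'a::quantale)"
  by (metis mult.commute mult_mono_quantale order.trans)

lemma le_one_quantale: "a \<le> (1::'a::quantale)"
  by (metis top_eq_one top_greatest)

lemma mult_le_left_quantale: "a * b \<le> (a::'a::quantale)"
  by (metis le_one_quantale mult.right_neutral mult_mono_quantale)

lemma mult_le_right_quantale: "a * b \<le> (b::'a::quantale)"
  by (metis mult.commute mult_le_left_quantale)

lemma perp_mult: "a * perp a = (bot::'a::quantale)"
proof -
  have "Sup ((*) a ` {x. a * x = bot}) \<le> bot"
    by (rule Sup_least) auto
  then show ?thesis
    unfolding perp_def mult_Sup by (simp add: bot_unique)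
qed

lemma le_perp_iff: "x \<le> perp a \<longleftrightarrow> a * x = (bot::'a::quantale)"
proof
  assume "x \<le> perp a"
  then show "a * x = bot"
    by (metis bot_unique mult_mono_quantale perp_mult)
qed (auto simp: perp_def intro: Sup_upper)

lemma complemented_elements_iff:
  "e \<in> complemented_elements \<longleftrightarrow> (\<exists>f. sup e f = (1::'a::quantale) \<and> inf e f = bot)"
proof
  assume e: "e \<in> complemented_elements"
  then have 1: "sup e (perp e) = 1"
    by (simp add: complemented_elements_def)
  have "inf e (perp e) = inf e (perp e) * sup e (perp e)"
    by (simp add: 1)
  also have "\<dots> = sup (inf e (perp e) * e) (inf e (perp e) * perp e)"
    by (rule mult_sup_quantale)
  also have "\<dots> \<le> bot"
    by (metis inf.cobounded1 inf.cobounded2 le_sup_iff mult.commute mult_mono_quantale perp_mult)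
  finally have "inf e (perp e) = bot"
    by (simp add: bot_unique)
  with 1 show "\<exists>f. sup e f = 1 \<and> inf e f = bot"
    by blast
next
  assume "\<exists>f. sup e f = 1 \<and> inf e f = bot"
  then obtain f where f: "sup e f = 1" "inf e f = bot"
    by blast
  have "e * f \<le> inf e f"
    by (simp add: mult_le_left_quantale mult_le_right_quantale)
  then have "f \<le> perp e"
    by (simp add: f le_perp_iff bot_unique)
  then have "1 \<le> sup e (perp e)"
    by (metis f(1) sup.mono order_refl)
  then show "e \<in> complemented_elements"
    by (simp add: complemented_elements_def antisym le_one_quantale)
qed

lemma spec_basic_Sup: "spec_basic (Sup S) = (\<Union>a\<in>S. spec_basic a)"
  by (auto simp: spec_basic_def Sup_le_iff)

lemma spec_basic_mult: "spec_basic (a * b) = spec_basic a \<inter> spec_basic b"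
proof -
  have "a * b \<le> p \<longleftrightarrow> a \<le> p \<or> b \<le> p" if "p \<in> spec" for p
  proof
    show "a * b \<le> p \<Longrightarrow> a \<le> p \<or> b \<le> p"
      using that by (simp add: spec_def)
    show "a \<le> p \<or> b \<le> p \<Longrightarrow> a * b \<le> p"
      by (metis mult_le_left_quantale mult_le_right_quantale order.trans)
  qed
  then show ?thesis
    unfolding spec_basic_def by blast
qed

lemma openin_spec_Z: "openin spec_Z U \<longleftrightarrow> (\<exists>a. U = spec_basic a)"
proof -
  have "istopology (\<lambda>U. \<exists>a::'a. U = spec_basic a)"
    unfolding istopology_def
  proof (intro conjI allI impI)
    fix S T :: "'a set"
    assume "\<exists>a. S = spec_basic a" "\<exists>a. T = spec_basic a"
    then show "\<exists>a. S \<inter> T = spec_basic a"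
      by (metis spec_basic_mult)
  next
    fix \<K> :: "'a set set"
    assume "\<forall>K\<in>\<K>. \<exists>a. K = spec_basic a"
    then obtain f where "\<forall>K\<in>\<K>. K = spec_basic (f K)"
      by metis
    then have "\<Union> \<K> = spec_basic (Sup (f ` \<K>))"
      by (auto simp: spec_basic_Sup)
    then show "\<exists>a. \<Union> \<K> = spec_basic a"
      by blast
  qed
  then show ?thesis
    by (simp add: spec_Z_def topology_inverse')
qed

lemma topspace_spec_Z: "topspace spec_Z = spec"
proof -
  have "spec_basic 1 = (spec :: 'a set)"
    by (auto simp: spec_basic_def spec_def)
  then have "openin spec_Z (spec :: 'a set)"
    by (metis openin_spec_Z)
  moreover have "U \<subseteq> spec" if "openin spec_Z U" for U :: "'a set"
    using that by (auto simp: openin_spec_Z spec_basic_def)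
  ultimately show ?thesis
    by (meson openin_subset openin_topspace subset_antisym)
qed

lemma pure_one: "(1::'a::quantale) \<in> pure_elements"
  by (simp add: pure_elements_def top_eq_one[symmetric])

lemma sup_mult_eq_one:
  assumes "sup a x = 1" "sup b y = (1::'a::quantale)"
  shows "sup (a * b) (sup x y) = 1" "sup (sup a b) (x * y) = 1"
proof -
  have "1 = sup a x * sup b y"
    by (simp add: assms)
  also have "\<dots> = sup (sup (a * b) (a * y)) (sup (x * b) (x * y))"
    by (metis mult.commute mult_sup_quantale sup_assoc sup_commute sup_left_commute)
  finally have *: "1 = sup (sup (a * b) (a * y)) (sup (x * b) (x * y))" .
  have "1 \<le> sup (a * b) (sup x y)"
    unfolding * by (meson le_supI le_supI1 le_supI2 mult_le_left_quantale mult_le_right_quantale order_refl)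
  then show "sup (a * b) (sup x y) = 1"
    by (simp add: antisym le_one_quantale)
  have "1 \<le> sup (sup a b) (x * y)"
    unfolding * by (meson le_supI le_supI1 le_supI2 mult_le_left_quantale mult_le_right_quantale order_refl)
  then show "sup (sup a b) (x * y) = 1"
    by (simp add: antisym le_one_quantale)
qed

lemma pure_inf:
  assumes "a \<in> pure_elements" "b \<in> pure_elements"
  shows "inf a b \<in> (pure_elements :: 'a::quantale set)"
  unfolding pure_elements_def
proof (intro CollectI allI impI)
  fix c :: 'a
  assume "compact_element c" "c \<le> inf a b"
  then have "sup a (perp c) = 1" "sup b (perp c) = 1"
    using assms by (auto simp: pure_elements_def)
  then have "sup (a * b) (perp c) = 1"
    using sup_mult_eq_one(1) by fastforce
  moreover have "a * b \<le> inf a b"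
    by (simp add: mult_le_left_quantale mult_le_right_quantale)
  ultimately have "1 \<le> sup (inf a b) (perp c)"
    by (metis order_refl sup.mono)
  then show "sup (inf a b) (perp c) = 1"
    by (simp add: antisym le_one_quantale)
qed

lemma pure_Sup:
  assumes S: "S \<subseteq> pure_elements"
  shows "Sup S \<in> (pure_elements :: 'a::coherent_quantale set)"
  unfolding pure_elements_def
proof (intro CollectI allI impI)
  fix c :: 'a
  assume c: "compact_element c" "c \<le> Sup S"
  define T where "T = {d. compact_element d \<and> (\<exists>s\<in>S. d \<le> s)}"
  have "s \<le> Sup T" if s: "s \<in> S" for s
  proof -
    obtain C where C: "\<forall>c\<in>C. compact_element c" "s = Sup C"
      using algebraic by blast
    then have "C \<subseteq> T"
      using s by (auto simp: T_def intro: Sup_upper)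
    then show ?thesis
      using C Sup_subset_mono by blast
  qed
  then have "c \<le> Sup T"
    by (meson Sup_le_iff c(2) order.trans)
  then obtain F where F: "finite F" "F \<subseteq> T" "c \<le> Sup F"
    using c(1) compact_element_def by blast
  have "sup (Sup S) (perp (Sup F)) = 1"
    using F(1,2)
  proof (induction F)
    case empty
    have "perp (bot::'a) = top"
      by (metis bot_unique le_perp_iff mult_le_left_quantale top_unique)
    then show ?case
      by (metis Sup_empty sup_top_right top_eq_one)
  next
    case (insert d F)
    then obtain s where s: "s \<in> S" "d \<le> s" "compact_element d"
      by (auto simp: T_def)
    then have "sup s (perp d) = 1"
      using S by (auto simp: pure_elements_def)
    then have "1 \<le> sup (Sup S) (perp d)"
      by (metis Sup_upper order_refl s(1) sup.mono)
    then have 1: "sup (Sup S) (perp d) = 1"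
      by (simp add: antisym le_one_quantale)
    have 2: "sup (Sup S) (perp (Sup F)) = 1"
      using insert by simp
    have "sup (Sup S) (perp d * perp (Sup F)) = 1"
      using sup_mult_eq_one(2)[OF 1 2] by simp
    moreover have "perp d * perp (Sup F) \<le> perp (sup d (Sup F))"
    proof -
      have "d * (perp d * perp (Sup F)) = bot"
        by (metis bot_unique mult.assoc mult_le_left_quantale perp_mult)
      moreover have "Sup F * (perp d * perp (Sup F)) = bot"
        by (metis bot_unique mult.left_commute mult_le_right_quantale perp_mult)
      ultimately show ?thesis
        by (metis le_perp_iff mult.commute mult_sup_quantale sup.idem)
    qed
    ultimately have "1 \<le> sup (Sup S) (perp (sup d (Sup F)))"
      by (metis order_refl sup.mono)
    then show ?case
      by (simp add: antisym le_one_quantale)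
  qed
  moreover have "perp (Sup F) \<le> perp c"
    by (metis F(3) bot_unique le_perp_iff mult.commute mult_mono_quantale perp_mult)
  ultimately have "1 \<le> sup (Sup S) (perp c)"
    by (metis order_refl sup.mono)
  then show "sup (Sup S) (perp c) = 1"
    by (simp add: antisym le_one_quantale)
qed

lemma openin_vir_spec_Z:
  "openin vir_spec_Z U \<longleftrightarrow>
     (\<exists>a\<in>pure_elements. U = {p \<in> vir_spec. \<not> a \<le> (p::'a::coherent_quantale)})"
proof -
  have "istopology (\<lambda>U. \<exists>a\<in>pure_elements. U = {p \<in> vir_spec. \<not> a \<le> (p::'a)})"
    unfolding istopology_def
  proof (intro conjI allI impI)
    fix S T :: "'a set"
    assume "\<exists>a\<in>pure_elements. S = {p \<in> vir_spec. \<not> a \<le> p}"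
      and "\<exists>a\<in>pure_elements. T = {p \<in> vir_spec. \<not> a \<le> p}"
    then obtain a b where ab: "a \<in> pure_elements" "b \<in> pure_elements"
      and ST: "S = {p \<in> vir_spec. \<not> a \<le> p}" "T = {p \<in> vir_spec. \<not> b \<le> p}"
      by blast
    have "S \<inter> T = {p \<in> vir_spec. \<not> inf a b \<le> p}"
      unfolding ST using ab by (auto simp: vir_spec_def intro: le_infI1 le_infI2)
    then show "\<exists>a\<in>pure_elements. S \<inter> T = {p \<in> vir_spec. \<not> a \<le> p}"
      using pure_inf[OF ab] by blast
  next
    fix \<K> :: "'a set set"
    assume "\<forall>K\<in>\<K>. \<exists>a\<in>pure_elements. K = {p \<in> vir_spec. \<not> a \<le> p}"
    then obtain f where f: "\<forall>K\<in>\<K>. f K \<in> pure_elements \<and> K = {p \<in> vir_spec. \<not> f K \<le> p}"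
      by metis
    have "\<Union> \<K> = (\<Union>K\<in>\<K>. {p \<in> vir_spec. \<not> f K \<le> p})"
      using f by auto
    also have "\<dots> = {p \<in> vir_spec. \<not> Sup (f ` \<K>) \<le> p}"
      by (auto simp: Sup_le_iff)
    finally have "\<Union> \<K> = {p \<in> vir_spec. \<not> Sup (f ` \<K>) \<le> p}" .
    moreover have "Sup (f ` \<K>) \<in> pure_elements"
      using f by (intro pure_Sup) auto
    ultimately show "\<exists>a\<in>pure_elements. \<Union> \<K> = {p \<in> vir_spec. \<not> a \<le> p}"
      by blast
  qed
  then show ?thesis
    by (simp add: vir_spec_Z_def topology_inverse')
qed

lemma openin_spec_Id_Z:
  "openin spec_Id_Z = arbitrary union_of (\<lambda>U. \<exists>x. U = {P \<in> prime_ideals. x \<notin> P})"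
proof -
  have int: "{P \<in> prime_ideals. x \<notin> P} \<inter> {P \<in> prime_ideals. y \<notin> P}
      = {P \<in> prime_ideals. inf x y \<notin> P}" for x y :: 'a
  proof -
    have "inf x y \<in> P \<longleftrightarrow> x \<in> P \<or> y \<in> P" if "P \<in> prime_ideals" for P
    proof
      show "inf x y \<in> P \<Longrightarrow> x \<in> P \<or> y \<in> P"
        using that by (simp add: prime_ideals_def)
      have "\<forall>x\<in>P. \<forall>y. y \<le> x \<longrightarrow> y \<in> P"
        using that by (simp add: prime_ideals_def lattice_ideal_def)
      then show "x \<in> P \<or> y \<in> P \<Longrightarrow> inf x y \<in> P"
        by (metis inf.cobounded1 inf.cobounded2)
    qed
    then show ?thesis
      by blast
  qed
  have "istopology (arbitrary union_of (\<lambda>U. \<exists>x::'a. U = {P \<in> prime_ideals. x \<notin> P}))"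
  proof (rule istopology_base, elim exE)
    fix S T :: "'a set set" and x y
    assume "S = {P \<in> prime_ideals. x \<notin> P}" "T = {P \<in> prime_ideals. y \<notin> P}"
    then have "S \<inter> T = {P \<in> prime_ideals. inf x y \<notin> P}"
      by (simp only: int)
    then show "\<exists>x. S \<inter> T = {P \<in> prime_ideals. x \<notin> P}"
      by (rule exI)
  qed
  then show ?thesis
    by (simp add: spec_Id_Z_def topology_inverse')
qed


section \<open>Existence of the reticulation\<close>

text \<open>Every coherent quantale type has a reticulation type, so quantifying over all maps that
  satisfy \<open>is_reticulation\<close> is not vacuous.\<close>

definition radical_set :: "'a::coherent_quantale \<Rightarrow> 'a set" where
  "radical_set c = {x. compact_element x \<and> (\<exists>n\<ge>1. x ^ n \<le> c)}"

typedef (overloaded) 'a reticulation = "radical_set ` {c::'a::coherent_quantale. compact_element c}"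
  using compact_one by blast

definition retic :: "'a::coherent_quantale \<Rightarrow> 'a reticulation" where
  "retic c = Abs_reticulation (radical_set c)"

definition retic_rep :: "'a::coherent_quantale reticulation \<Rightarrow> 'a" where
  "retic_rep x = (SOME c. compact_element c \<and> retic c = x)"

lemma power_mono_quantale: "a \<le> b \<Longrightarrow> a ^ n \<le> (b::'a::quantale) ^ n"
  by (induction n) (simp_all add: mult_mono2_quantale)

lemma power_sup_quantale: "sup c d ^ (n + m) \<le> sup (c ^ n) ((d::'a::quantale) ^ m)"
proof (induction "n + m" arbitrary: n m)
  case 0
  then show ?case by simp
next
  case (Suc k)
  show ?case
  proof (cases n)
    case 0
    then show ?thesis by (simp add: le_supI1 le_one_quantale)
  next
    case n: (Suc n')
    show ?thesis
    proof (cases m)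
      case 0
      then show ?thesis by (simp add: le_supI2 le_one_quantale)
    next
      case m: (Suc m')
      have 1: "sup c d ^ k \<le> sup (c ^ n') (d ^ m)" "sup c d ^ k \<le> sup (c ^ n) (d ^ m')"
        using Suc.hyps(1)[of n' m] Suc.hyps(1)[of n m'] Suc.hyps(2) n m by auto
      have "sup c d ^ (n + m) = sup (sup c d ^ k * c) (sup c d ^ k * d)"
        by (metis Suc.hyps(2) mult_sup_quantale power_Suc2)
      also have "\<dots> \<le> sup (sup (c ^ n') (d ^ m) * c) (sup (c ^ n) (d ^ m') * d)"
        by (intro sup.mono mult_mono2_quantale 1 order_refl)
      also have "\<dots> \<le> sup (c ^ n) (d ^ m)"
      proof (rule sup.boundedI)
        show "sup (c ^ n') (d ^ m) * c \<le> sup (c ^ n) (d ^ m)"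
          unfolding n mult.commute[of _ c] mult_sup_quantale
          by (simp add: le_supI2 mult_le_right_quantale)
        show "sup (c ^ n) (d ^ m') * d \<le> sup (c ^ n) (d ^ m)"
          unfolding m mult.commute[of _ d] mult_sup_quantale
          by (simp add: le_supI1 mult_le_right_quantale)
      qed
      finally show ?thesis .
    qed
  qed
qed

lemma compact_sup:
  assumes "compact_element c" "compact_element (d::'a::complete_lattice)"
  shows "compact_element (sup c d)"
  unfolding compact_element_def
proof (intro allI impI)
  fix S :: "'a set"
  assume "sup c d \<le> Sup S"
  then obtain F G where "finite F" "F \<subseteq> S" "c \<le> Sup F" "finite G" "G \<subseteq> S" "d \<le> Sup G"
    using assms unfolding compact_element_def by (metis le_sup_iff)
  then show "\<exists>F. finite F \<and> F \<subseteq> S \<and> sup c d \<le> Sup F"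
    by (intro exI[of _ "F \<union> G"]) (auto simp: Sup_union_distrib intro: le_supI1 le_supI2)
qed

lemma compact_bot: "compact_element (bot::'a::complete_lattice)"
  unfolding compact_element_def by (auto intro: exI[of _ "{}"])

lemma radical_set_subset_iff:
  assumes "compact_element c"
  shows "radical_set c \<subseteq> radical_set d \<longleftrightarrow> (\<exists>n\<ge>1. c ^ n \<le> d)"
proof
  assume "radical_set c \<subseteq> radical_set d"
  moreover have "c \<in> radical_set c"
    using assms by (auto simp: radical_set_def intro!: exI[of _ 1])
  ultimately show "\<exists>n\<ge>1. c ^ n \<le> d"
    by (auto simp: radical_set_def)
next
  assume "\<exists>n\<ge>1. c ^ n \<le> d"
  then obtain n where n: "n \<ge> 1" "c ^ n \<le> d"
    by blast
  show "radical_set c \<subseteq> radical_set d"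
  proof
    fix x
    assume "x \<in> radical_set c"
    then obtain m where x: "compact_element x" and m: "m \<ge> 1" "x ^ m \<le> c"
      by (auto simp: radical_set_def)
    have "x ^ (m * n) \<le> d"
      by (metis m(2) n(2) order.trans power_mono_quantale power_mult)
    moreover have "m * n \<ge> 1"
      using m n by simp
    ultimately show "x \<in> radical_set d"
      using x unfolding radical_set_def by blast
  qed
qed

lemma retic_cases: obtains c where "compact_element c" "x = retic c"
  by (cases x) (auto simp: retic_def)

lemma retic_rep: "compact_element (retic_rep x)" "retic (retic_rep x) = x"
proof -
  have "\<exists>c. compact_element c \<and> retic c = x"
    by (metis retic_cases)
  then show "compact_element (retic_rep x)" "retic (retic_rep x) = x"
    unfolding retic_rep_def by (metis (mono_tags, lifting) someI_ex)+
qed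

instantiation reticulation :: (coherent_quantale) "{distrib_lattice,bounded_lattice}"
begin

definition "x \<le> y \<longleftrightarrow> Rep_reticulation x \<subseteq> Rep_reticulation y"
definition "x < y \<longleftrightarrow> Rep_reticulation x \<subset> Rep_reticulation y"
definition "sup x y = retic (sup (retic_rep x) (retic_rep y))"
definition "inf x y = retic (retic_rep x * retic_rep y)"
definition "bot = retic bot"
definition "top = retic 1"

lemma retic_le_iff:
  "compact_element c \<Longrightarrow> compact_element d \<Longrightarrow> retic c \<le> retic d \<longleftrightarrow> (\<exists>n\<ge>1. c ^ n \<le> d)"
  by (simp add: less_eq_reticulation_def retic_def Abs_reticulation_inverse radical_set_subset_iff)

lemma retic_mono: "compact_element c \<Longrightarrow> compact_element d \<Longrightarrow> c \<le> d \<Longrightarrow> retic c \<le> retic d"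
  by (subst retic_le_iff) (auto intro!: exI[of _ 1])

lemma retic_inf_greatest:
  assumes c: "compact_element e" "compact_element c" "compact_element d"
    and "retic e \<le> retic c" "retic e \<le> retic d"
  shows "retic e \<le> retic (c * d)"
proof -
  obtain n m where "n \<ge> 1" "e ^ n \<le> c" "m \<ge> 1" "e ^ m \<le> d"
    using assms by (auto simp: retic_le_iff)
  then have "n + m \<ge> 1" "e ^ (n + m) \<le> c * d"
    by (auto simp: power_add mult_mono2_quantale)
  then show ?thesis
    using c retic_le_iff compact_mult by blast
qed

lemma retic_sup_least:
  assumes c: "compact_element e" "compact_element c" "compact_element d"
    and "retic c \<le> retic e" "retic d \<le> retic e"
  shows "retic (sup c d) \<le> retic e"
proof -
  obtain n m where nm: "n \<ge> 1" "c ^ n \<le> e" "m \<ge> 1" "d ^ m \<le> e"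
    using assms by (auto simp: retic_le_iff)
  then have "sup c d ^ (n + m) \<le> e"
    by (meson le_supI order.trans power_sup_quantale)
  moreover have "n + m \<ge> 1"
    using nm by simp
  ultimately show ?thesis
    using c retic_le_iff compact_sup by blast
qed

lemma retic_order:
  fixes x y z :: "'a reticulation"
  shows "x \<le> x" "x \<le> y \<Longrightarrow> y \<le> z \<Longrightarrow> x \<le> z" "x \<le> y \<Longrightarrow> y \<le> x \<Longrightarrow> x = y"
  by (auto simp: less_eq_reticulation_def Rep_reticulation_inject)

lemma retic_sup_inf:
  assumes "compact_element c" "compact_element (d::'a)"
  shows "sup (retic c) (retic d) = retic (sup c d)" "inf (retic c) (retic d) = retic (c * d)"
proof -
  define c' d' where "c' = retic_rep (retic c)" and "d' = retic_rep (retic d)"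
  have *: "compact_element c'" "compact_element d'" "retic c' = retic c" "retic d' = retic d"
    by (simp_all add: c'_def d'_def retic_rep)
  note cs = compact_sup compact_mult * assms
  have le: "retic (sup a b) \<le> retic (sup a' b')" "retic (a * b) \<le> retic (a' * b')"
    if c: "compact_element a" "compact_element b" "compact_element a'" "compact_element b'"
      and eq: "retic a = retic a'" "retic b = retic b'" for a b a' b' :: 'a
  proof -
    note cs = c compact_sup compact_mult
    show "retic (sup a b) \<le> retic (sup a' b')"
      by (rule retic_sup_least) (simp_all add: cs eq retic_mono)
    show "retic (a * b) \<le> retic (a' * b')"
      by (rule retic_inf_greatest)
        (simp_all add: cs eq[symmetric] retic_mono mult_le_left_quantale mult_le_right_quantale)
  qed
  show "sup (retic c) (retic d) = retic (sup c d)"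
    unfolding sup_reticulation_def c'_def[symmetric] d'_def[symmetric]
    by (rule retic_order(3)) (rule le; simp add: * assms)+
  show "inf (retic c) (retic d) = retic (c * d)"
    unfolding inf_reticulation_def c'_def[symmetric] d'_def[symmetric]
    by (rule retic_order(3)) (rule le; simp add: * assms)+
qed

instance
proof
  fix x y z :: "'a reticulation"
  obtain c d e where c: "compact_element c" "compact_element d" "compact_element e"
    and x: "x = retic c" "y = retic d" "z = retic e"
    by (metis retic_cases)
  note cs = c compact_sup compact_mult
  show "(x < y) = (x \<le> y \<and> \<not> y \<le> x)"
    by (auto simp: less_eq_reticulation_def less_reticulation_def)
  show "x \<le> x" by (rule retic_order)
  show "x \<le> y \<Longrightarrow> y \<le> z \<Longrightarrow> x \<le> z" by (rule retic_order)
  show "x \<le> y \<Longrightarrow> y \<le> x \<Longrightarrow> x = y" by (rule retic_order)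
  show "inf x y \<le> x" "inf x y \<le> y"
    by (simp_all add: x retic_sup_inf cs retic_mono mult_le_left_quantale mult_le_right_quantale)
  show "x \<le> y \<Longrightarrow> x \<le> z \<Longrightarrow> x \<le> inf y z"
    by (simp add: x retic_sup_inf cs retic_inf_greatest)
  show "x \<le> sup x y" "y \<le> sup x y"
    by (simp_all add: x retic_sup_inf cs retic_mono)
  show "y \<le> x \<Longrightarrow> z \<le> x \<Longrightarrow> sup y z \<le> x"
    by (simp add: x retic_sup_inf cs retic_sup_least)
  show "bot \<le> x"
    by (simp add: x bot_reticulation_def retic_mono c compact_bot)
  show "x \<le> top"
    by (simp add: x top_reticulation_def retic_mono c compact_one le_one_quantale)
  show "sup x (inf y z) = inf (sup x y) (sup x z)"
  proof (rule retic_order(3))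
    have "sup c (d * e) \<le> sup c d" "sup c (d * e) \<le> sup c e"
      by (simp_all add: le_supI2 mult_le_left_quantale mult_le_right_quantale)
    then show "sup x (inf y z) \<le> inf (sup x y) (sup x z)"
      by (simp add: x retic_sup_inf cs retic_inf_greatest retic_mono)
    have "sup c d * sup c e = sup (c * sup c d) (sup (c * e) (d * e))"
      by (metis mult.commute mult_sup_quantale)
    also have "\<dots> \<le> sup c (d * e)"
      by (meson le_supI le_supI1 le_supI2 mult_le_left_quantale order_refl)
    finally show "inf (sup x y) (sup x z) \<le> sup x (inf y z)"
      by (simp add: x retic_sup_inf cs retic_mono)
  qed
qed

end

theorem is_reticulation_retic:
  "is_reticulation (retic :: 'a::coherent_quantale \<Rightarrow> 'a reticulation)"
proof -
  have "x \<in> retic ` {c::'a. compact_element c}" for x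
    by (metis image_eqI mem_Collect_eq retic_rep)
  then show ?thesis
    unfolding is_reticulation_def by (auto simp: retic_sup_inf retic_le_iff)
qed

end

(*
  In a PF-quantale every m-prime p has a unique minimal m-prime O(p) below it, the join of the
  compact c whose annihilator is not below p; so a compact c lies below a minimal m-prime p iff its
  annihilator does not. Minimal m-primes are pure, and they are exactly the primes of the frame of
  pure elements. If every c^perp is complemented, O is continuous, since c \<le> O(p) iff
  c^perp^perp \<le> p, and retracts the compact Spec onto Min. If Min is compact, then so is its closed
  subset of the p above c, on which c^perp may be replaced by a compact d \<le> c^perp; then
  d^perp \<le> c^perp^perp, and c^perp is complemented because it is pure. If Min \<inter> D(c) is cut out by
  a pure element a, then a is a complement of c^perp. The lattice side is transported along the
  homeomorphism from Spec(A) to the space of prime ideals of L(A).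
*)

theory Submission
  imports Defs
begin

section \<open>Compact elements and annihilators\<close>

text \<open>Algebraicity. Inequalities are tested on compact elements because the criteria for
  annihilators and for reticulations speak of these.\<close>

lemma le_iff_compact_le:
  fixes a b :: "'a::coherent_quantale"
  shows "a \<le> b \<longleftrightarrow> (\<forall>c. compact_element c \<longrightarrow> c \<le> a \<longrightarrow> c \<le> b)"
proof
  assume *: "\<forall>c. compact_element c \<longrightarrow> c \<le> a \<longrightarrow> c \<le> b"
  obtain C where "\<forall>c\<in>C. compact_element c" "a = Sup C"
    using algebraic by blast
  then show "a \<le> b"
    using * by (auto intro!: Sup_least dest: Sup_upper)
qed (auto intro: order.trans)

lemma not_le_compact:
  fixes a b :: "'a::coherent_quantale"
  assumes "\<not> a \<le> b"
  obtains c where "compact_element c" "c \<le> a" "\<not> c \<le> b"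
  using assms le_iff_compact_le by blast

lemma compact_le_SupE:
  assumes "compact_element c" "c \<le> Sup S"
  obtains F where "finite F" "F \<subseteq> S" "c \<le> Sup F"
  using assms unfolding compact_element_def by blast

lemma compact_Sup:
  fixes F :: "'a::complete_lattice set"
  assumes "finite F" "\<And>c. c \<in> F \<Longrightarrow> compact_element c"
  shows "compact_element (Sup F)"
  using assms by (induction F) (simp_all add: compact_bot compact_sup)

lemma compact_power:
  "compact_element c \<Longrightarrow> compact_element (c ^ n :: 'a::coherent_quantale)"
  by (induction n) (simp_all add: compact_one compact_mult)

lemma mult_bot_quantale [simp]: "x * bot = (bot::'a::quantale)" "bot * x = (bot::'a::quantale)"
  by (metis bot_unique mult_le_right_quantale, metis bot_unique mult_le_left_quantale)

lemma perp_bot [simp]: "perp bot = (1::'a::quantale)"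
  by (simp add: antisym le_one_quantale le_perp_iff)

lemma perp_antimono: "a \<le> b \<Longrightarrow> perp b \<le> perp (a::'a::quantale)"
  by (metis bot_unique le_perp_iff mult.commute mult_mono_quantale perp_mult)

lemma perp_mult_perp_le_perp_sup: "perp a * perp b \<le> perp (sup a (b::'a::quantale))"
proof -
  have "a * (perp a * perp b) = bot" "b * (perp a * perp b) = bot"
    by (metis mult.assoc mult_bot_quantale(2) perp_mult,
        metis mult.left_commute mult_bot_quantale(1) perp_mult)
  then show ?thesis
    by (metis le_perp_iff mult.commute mult_sup_quantale sup.idem)
qed

lemma perp_perp_disjoint_of_sup_eq_one:
  assumes "sup d e = (1::'a::quantale)"
  shows "inf (perp d) (perp e) = bot"
proof -
  let ?x = "inf (perp d) (perp e)"
  have "?x * d = bot" "?x * e = bot"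
    by (metis inf.cobounded1 le_perp_iff mult.commute,
        metis inf.cobounded2 le_perp_iff mult.commute)
  then have "?x * sup d e = bot"
    by (simp add: mult_sup_quantale)
  then show ?thesis
    by (simp add: assms)
qed

text \<open>If \<open>e \<le> Sup S\<close>, then \<open>f\<close> and \<open>S\<close> together
  cover the unit; compactness of the unit leaves finitely many, and multiplying by \<open>e\<close>
  erases \<open>f\<close>.\<close>

lemma complemented_compact:
  assumes 1: "compact_element (1::'a::quantale)" and ef: "sup e f = (1::'a)" "e * f = bot"
  shows "compact_element e"
  unfolding compact_element_def
proof (intro allI impI)
  fix S
  assume S: "e \<le> Sup S"
  have "1 \<le> Sup (insert f S)"
    using S ef(1) by (metis Sup_insert order_refl sup.mono sup_commute)
  then obtain F where F: "finite F" "F \<subseteq> insert f S" "1 \<le> Sup F"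
    by (rule compact_le_SupE[OF 1])
  have "Sup F \<le> Sup (insert f (F - {f}))"
    by (rule Sup_subset_mono) auto
  then have *: "1 = sup f (Sup (F - {f}))"
    by (metis F(3) Sup_insert antisym le_one_quantale order.trans)
  have "e = e * sup f (Sup (F - {f}))"
    by (simp add: *[symmetric])
  also have "\<dots> = e * Sup (F - {f})"
    by (simp add: mult_sup_quantale ef)
  also have "\<dots> \<le> Sup (F - {f})"
    by (rule mult_le_right_quantale)
  finally show "\<exists>F. finite F \<and> F \<subseteq> S \<and> e \<le> Sup F"
    using F by (intro exI[of _ "F - {f}"]) auto
qed

lemma complemented_pure:
  assumes ef: "sup e f = (1::'a::quantale)" "e * f = bot"
  shows "e \<in> pure_elements"
proof -
  have "sup e (perp c) = 1" if "c \<le> e" for c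
  proof -
    have "f \<le> perp c"
      using ef(2) that by (metis le_perp_iff order.trans perp_antimono)
    then have "1 \<le> sup e (perp c)"
      by (metis ef(1) order_refl sup.mono)
    then show ?thesis
      by (simp add: antisym le_one_quantale)
  qed
  then show ?thesis
    by (simp add: pure_elements_def)
qed

lemma pure_sup_perp_eq_one:
  "a \<in> pure_elements \<Longrightarrow> compact_element c \<Longrightarrow> c \<le> a \<Longrightarrow> sup a (perp c) = (1::'a::quantale)"
  by (simp add: pure_elements_def)

lemma perp_pure: "pf_quantale TYPE('a::quantale) \<Longrightarrow> compact_element (c::'a) \<Longrightarrow> perp c \<in> pure_elements"
  by (simp add: pf_quantale_def)

text \<open>If \<open>c ^ Suc n\<close> vanishes, \<open>c\<close> lies below
  \<open>perp (c ^ n)\<close>, and purity makes this annihilator comaximal with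
  \<open>perp c\<close>. For positive \<open>n\<close> it contains \<open>perp c\<close>, so it is
  the unit and \<open>c ^ n\<close> vanishes already.\<close>

lemma pf_semiprime:
  assumes pf: "pf_quantale TYPE('a::coherent_quantale)" and c: "compact_element (c::'a)"
    and "c ^ n = bot"
  shows "c = bot"
  using assms(3)
proof (induction n)
  case 0
  then show ?case
    by (metis mult.right_neutral mult_bot_quantale(1) power_0)
next
  case (Suc n)
  then have "c \<le> perp (c ^ n)"
    by (simp add: le_perp_iff mult.commute)
  then have *: "sup (perp (c ^ n)) (perp c) = 1"
    using perp_pure[OF pf] pure_sup_perp_eq_one c compact_power by blast
  show ?case
  proof (cases n)
    case 0
    with Suc show ?thesis by simp
  next
    case (Suc m)
    then have "perp c \<le> perp (c ^ n)"
      by (simp add: perp_antimono mult_le_left_quantale)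
    then have "perp (c ^ n) = 1"
      using * by (simp add: sup.absorb1)
    then have "c ^ n = bot"
      by (metis mult.right_neutral perp_mult)
    then show ?thesis
      by (rule Suc.IH)
  qed
qed

section \<open>Prime elements\<close>

lemma spec_less_one: "p \<in> spec \<Longrightarrow> \<not> 1 \<le> (p::'a::quantale)"
  by (auto simp: spec_def)

lemma spec_mult_le_iff:
  assumes "(p::'a::quantale) \<in> spec"
  shows "a * b \<le> p \<longleftrightarrow> a \<le> p \<or> b \<le> p"
proof
  show "a * b \<le> p \<Longrightarrow> a \<le> p \<or> b \<le> p"
    using assms by (simp add: spec_def)
  show "a \<le> p \<or> b \<le> p \<Longrightarrow> a * b \<le> p"
    by (metis mult_le_left_quantale mult_le_right_quantale order.trans)
qed

lemma spec_power_le: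
  assumes "(p::'a::quantale) \<in> spec" "a ^ n \<le> p"
  shows "a \<le> p"
  using assms(2)
proof (induction n)
  case 0
  then show ?case
    using spec_less_one[OF assms(1)] by simp
qed (auto simp: spec_mult_le_iff[OF assms(1)])

lemma perp_le_spec: "(p::'a::quantale) \<in> spec \<Longrightarrow> \<not> c \<le> p \<Longrightarrow> perp c \<le> p"
  by (metis bot_least perp_mult spec_mult_le_iff)

section \<open>Existence of m-prime elements\<close>

lemma spec_compactI:
  fixes p :: "'a::coherent_quantale"
  assumes "\<not> 1 \<le> p"
    and "\<And>a b. compact_element a \<Longrightarrow> compact_element b \<Longrightarrow> a * b \<le> p \<Longrightarrow> a \<le> p \<or> b \<le> p"
  shows "p \<in> spec"
proof -
  have "a \<le> p \<or> b \<le> p" if ab: "a * b \<le> p" for a b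
  proof (rule ccontr)
    assume "\<not> (a \<le> p \<or> b \<le> p)"
    then obtain c d where "compact_element c" "c \<le> a" "\<not> c \<le> p" "compact_element d" "d \<le> b" "\<not> d \<le> p"
      by (metis not_le_compact)
    then show False
      using assms(2) ab by (meson mult_mono2_quantale order.trans)
  qed
  moreover have "p < 1"
    using assms(1) by (simp add: le_one_quantale less_le_not_le)
  ultimately show ?thesis
    by (simp add: spec_def)
qed

text \<open>Two factors not below \<open>m\<close> are both comaximal with \<open>m\<close>, and
  then so is their product.\<close>

lemma maximal_in_spec:
  assumes m: "\<not> 1 \<le> (m::'a::quantale)" "\<And>x. m \<le> x \<Longrightarrow> \<not> 1 \<le> x \<Longrightarrow> x = m"
  shows "m \<in> spec"
proof -
  have "a \<le> m \<or> b \<le> m" if ab: "a * b \<le> m" for a b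
  proof (rule ccontr)
    assume n: "\<not> (a \<le> m \<or> b \<le> m)"
    have "sup m a = 1" "sup m b = 1"
      using n m(2)[of "sup m a"] m(2)[of "sup m b"]
      by (metis antisym le_one_quantale sup.cobounded1 sup.cobounded2)+
    then have "sup (sup m m) (a * b) = 1"
      by (rule sup_mult_eq_one(2))
    then show False
      using ab m(1) by (simp add: sup.absorb1)
  qed
  moreover have "m < 1"
    using m(1) by (simp add: le_one_quantale less_le_not_le)
  ultimately show ?thesis
    by (simp add: spec_def)
qed

text \<open>Zorn's lemma; compactness of the unit keeps the join of a chain away from the
  unit.\<close>

lemma exists_spec_above:
  fixes a :: "'a::quantale"
  assumes one: "compact_element (1::'a)" and a: "\<not> 1 \<le> a"
  obtains m where "m \<in> spec" "a \<le> m"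
proof -
  let ?A = "{x. a \<le> x \<and> \<not> 1 \<le> x}"
  have "\<exists>m\<in>?A. \<forall>x\<in>?A. m \<le> x \<longrightarrow> x = m"
  proof (rule predicate_Zorn)
    show "partial_order_on ?A (relation_of (\<le>) ?A)"
      by (rule partial_order_on_relation_ofI) auto
    fix C
    assume "C \<in> Chains (relation_of (\<le>) ?A)"
    then have C: "C \<subseteq> ?A" "\<And>x y. x \<in> C \<Longrightarrow> y \<in> C \<Longrightarrow> x \<le> y \<or> y \<le> x"
      by (auto simp: Chains_def relation_of_def)
    \<comment> \<open>Joining \<open>a\<close> provides an upper bound for the empty chain too.
      Since \<open>a\<close> lies below all of \<open>C\<close>, the set \<open>insert a C\<close>
      is still a chain.\<close>
    have "\<not> 1 \<le> sup a (Sup C)"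
    proof
      assume "1 \<le> sup a (Sup C)"
      then obtain F where F: "finite F" "F \<subseteq> insert a C" "1 \<le> Sup F"
        by (metis compact_le_SupE[OF one] Sup_insert)
      have "\<exists>u\<in>insert a C. Sup F \<le> u"
        using F(1,2)
      proof (induction F)
        case (insert x F)
        then obtain u where u: "u \<in> insert a C" "Sup F \<le> u"
          by auto
        have x: "x \<in> insert a C"
          using insert by simp
        have "x \<le> u \<or> u \<le> x"
          using u(1) x C by auto
        then show ?case
          using u x by (metis Sup_insert le_sup_iff order.trans order_refl)
      qed auto
      then show False
        using F(3) a C(1) order.trans by blast
    qed
    then show "\<exists>u\<in>?A. \<forall>x\<in>C. x \<le> u"
      by (intro bexI[of _ "sup a (Sup C)"]) (auto intro: le_supI2 Sup_upper)
  qed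
  then obtain m where "m \<in> ?A" "\<And>x. x \<in> ?A \<Longrightarrow> m \<le> x \<Longrightarrow> x = m"
    by blast
  then have "m \<in> spec" "a \<le> m"
    by (auto intro!: maximal_in_spec dest: order.trans)
  then show ?thesis
    by (rule that)
qed

text \<open>Turns a comaximality claim into a test at each m-prime.\<close>

lemma eq_one_if_no_spec_above:
  fixes a :: "'a::quantale"
  assumes "compact_element (1::'a)" "\<And>m. m \<in> spec \<Longrightarrow> \<not> a \<le> m"
  shows "a = 1"
  using assms exists_spec_above[of a] by (metis antisym le_one_quantale)

section \<open>Minimal primes of a PF-quantale\<close>

text \<open>This is O(p). For the ideals of a commutative ring it is the kernel of the localization
  at p.\<close>

definition min_below :: "'a::quantale \<Rightarrow> 'a" where
  "min_below p = Sup {c. compact_element c \<and> \<not> perp c \<le> p}"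

text \<open>The elements in the defining join are closed under finite joins, because a product of
  annihilators lies below the annihilator of the join and \<open>p\<close> is prime. Compactness of
  \<open>c\<close> then leaves a single finite join.\<close>

lemma compact_le_min_below_iff:
  assumes p: "(p::'a::quantale) \<in> spec" and c: "compact_element c"
  shows "c \<le> min_below p \<longleftrightarrow> \<not> perp c \<le> p"
proof
  assume "c \<le> min_below p"
  then obtain F where F: "finite F" "F \<subseteq> {c. compact_element c \<and> \<not> perp c \<le> p}" "c \<le> Sup F"
    unfolding min_below_def by (rule compact_le_SupE[OF c])
  have "\<not> perp (Sup F) \<le> p"
    using F(1,2)
  proof (induction F)
    case empty
    show ?case
      using spec_less_one[OF p] by simp
  next
    case (insert d F)
    then have "\<not> perp d * perp (Sup F) \<le> p"
      by (simp add: spec_mult_le_iff[OF p])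
    then show ?case
      using perp_mult_perp_le_perp_sup by (metis Sup_insert order.trans)
  qed
  then show "\<not> perp c \<le> p"
    using F(3) perp_antimono order.trans by blast
qed (auto simp: min_below_def c intro: Sup_upper)

lemma min_below_le:
  assumes "(p::'a::quantale) \<in> spec"
  shows "min_below p \<le> p"
  unfolding min_below_def using perp_le_spec[OF assms] by (auto intro: Sup_least)

lemma min_below_mono:
  assumes "p \<le> (q::'a::quantale)"
  shows "min_below q \<le> min_below p"
  unfolding min_below_def by (rule Sup_subset_mono) (use assms in \<open>auto dest: order.trans\<close>)

text \<open>The PF condition enters here: some compact \<open>x\<close> not below \<open>p\<close>
  kills \<open>a * b\<close>, so \<open>x * a\<close> lies below the pure \<open>perp b\<close>.
  Hence \<open>perp b\<close> and \<open>perp (x * a)\<close> are comaximal and cannot both lie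
  below \<open>p\<close>.\<close>

lemma min_below_in_spec:
  fixes p :: "'a::coherent_quantale"
  assumes pf: "pf_quantale TYPE('a)" and p: "p \<in> spec"
  shows "min_below p \<in> spec"
proof (rule spec_compactI)
  show "\<not> 1 \<le> min_below p"
    using min_below_le[OF p] spec_less_one[OF p] order.trans by blast
  fix a b :: 'a
  assume ab: "compact_element a" "compact_element b" "a * b \<le> min_below p"
  then have "\<not> perp (a * b) \<le> p"
    by (simp add: compact_le_min_below_iff p compact_mult)
  then obtain x where x: "compact_element x" "x \<le> perp (a * b)" "\<not> x \<le> p"
    by (rule not_le_compact)
  have "x * a \<le> perp b"
    using x(2) by (simp add: le_perp_iff mult.commute mult.left_commute)
  then have 1: "sup (perp b) (perp (x * a)) = 1"
    using perp_pure[OF pf ab(2)] pure_sup_perp_eq_one ab(1) x(1) compact_mult by blast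
  have "\<not> perp a \<le> p" if b: "perp b \<le> p"
  proof
    assume "perp a \<le> p"
    \<comment> \<open>Since \<open>x\<close> is not below the prime \<open>p\<close>, it can be
      cancelled, which brings \<open>perp (x * a)\<close> below \<open>p\<close>.\<close>
    moreover have "x * perp (x * a) \<le> perp a"
      by (metis le_perp_iff mult.assoc mult.commute perp_mult)
    ultimately have "perp (x * a) \<le> p"
      using x(3) spec_mult_le_iff[OF p] order.trans by blast
    then show False
      using 1 b spec_less_one[OF p] by (metis le_sup_iff)
  qed
  then show "a \<le> min_below p \<or> b \<le> min_below p"
    using ab by (auto simp: compact_le_min_below_iff p)
qed

text \<open>\<open>min_below\<close> reverses the order: a prime
  \<open>q \<le> min_below p \<le> p\<close> satisfies
  \<open>min_below p \<le> min_below q \<le> q\<close>.\<close>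

lemma min_below_in_min_spec:
  fixes p :: "'a::coherent_quantale"
  assumes pf: "pf_quantale TYPE('a)" and p: "p \<in> spec"
  shows "min_below p \<in> min_spec"
proof -
  have "q = min_below p" if q: "q \<in> spec" "q \<le> min_below p" for q
  proof (rule antisym)
    have "min_below p \<le> min_below q"
      using q min_below_le[OF p] min_below_mono order.trans by blast
    then show "min_below p \<le> q"
      using min_below_le[OF q(1)] order.trans by blast
  qed (rule q)
  then show ?thesis
    using min_below_in_spec[OF assms] by (simp add: min_spec_def)
qed

lemma min_spec_subset: "min_spec \<subseteq> spec"
  by (auto simp: min_spec_def)

lemma min_below_min_spec:
  fixes p :: "'a::coherent_quantale"
  assumes pf: "pf_quantale TYPE('a)" and p: "p \<in> min_spec"
  shows "min_below p = p"
  using p min_below_in_spec[OF pf] min_below_le by (auto simp: min_spec_def)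

text \<open>The prime \<open>min_below q\<close> lies below \<open>min_below p = p\<close>, and
  \<open>p\<close> is minimal. So only one minimal prime lies below \<open>q\<close>.\<close>

lemma min_below_eq:
  fixes p :: "'a::coherent_quantale"
  assumes pf: "pf_quantale TYPE('a)" and p: "p \<in> min_spec" and q: "q \<in> spec" "p \<le> q"
  shows "min_below q = p"
  using min_below_mono[OF q(2)] min_below_in_spec[OF pf q(1)] p
  by (metis (mono_tags, lifting) min_below_min_spec[OF pf p] mem_Collect_eq min_spec_def)

lemma min_spec_compact_le_iff:
  fixes p :: "'a::coherent_quantale"
  assumes pf: "pf_quantale TYPE('a)" and p: "p \<in> min_spec" and c: "compact_element c"
  shows "c \<le> p \<longleftrightarrow> \<not> perp c \<le> p"
  using compact_le_min_below_iff[of p c] min_below_min_spec[OF pf p] p c min_spec_subset by auto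

text \<open>A compact \<open>c \<le> x\<close> lies below \<open>min_below m\<close> for every
  m-prime \<open>m\<close>, so \<open>perp c\<close> is below no m-prime and is the unit.\<close>

lemma bot_if_le_min_spec:
  fixes x :: "'a::coherent_quantale"
  assumes pf: "pf_quantale TYPE('a)" and x: "\<And>p. p \<in> min_spec \<Longrightarrow> x \<le> p"
  shows "x = bot"
proof -
  have "c = bot" if c: "compact_element c" "c \<le> x" for c
  proof -
    have "perp c = 1"
    proof (rule eq_one_if_no_spec_above[OF compact_one])
      fix m :: 'a
      assume m: "m \<in> spec"
      have "c \<le> min_below m"
        using c(2) x[OF min_below_in_min_spec[OF pf m]] order.trans by blast
      then show "\<not> perp c \<le> m"
        by (simp add: compact_le_min_below_iff m c)
    qed
    then show ?thesis
      by (metis mult.right_neutral perp_mult)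
  qed
  then show ?thesis
    by (metis bot_unique le_iff_compact_le order_refl)
qed

text \<open>A prime \<open>m\<close> above \<open>p\<close> and \<open>perp c\<close> would have
  \<open>min_below m = p\<close>, hence \<open>c \<le> min_below m\<close>, which excludes
  \<open>perp c \<le> m\<close>.\<close>

lemma min_spec_pure:
  fixes p :: "'a::coherent_quantale"
  assumes pf: "pf_quantale TYPE('a)" and p: "p \<in> min_spec"
  shows "p \<in> pure_elements"
  unfolding pure_elements_def
proof (intro CollectI allI impI)
  fix c
  assume c: "compact_element c" "c \<le> p"
  show "sup p (perp c) = 1"
  proof (rule eq_one_if_no_spec_above[OF compact_one])
    fix m :: 'a
    assume m: "m \<in> spec"
    show "\<not> sup p (perp c) \<le> m"
    proof
      assume "sup p (perp c) \<le> m"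
      then have "min_below m = p" "perp c \<le> m"
        using min_below_eq[OF pf p m] by auto
      then show False
        using c compact_le_min_below_iff[OF m] by simp
    qed
  qed
qed

text \<open>The annihilator of a compact \<open>c \<le> a\<close> is comaximal with
  \<open>a\<close>, so it cannot lie below \<open>m\<close>.\<close>

lemma pure_le_min_below:
  fixes a :: "'a::coherent_quantale"
  assumes a: "a \<in> pure_elements" and m: "m \<in> spec" "a \<le> m"
  shows "a \<le> min_below m"
  unfolding le_iff_compact_le[of a]
proof (intro allI impI)
  fix c
  assume c: "compact_element c" "c \<le> a"
  then have "sup a (perp c) = 1"
    using a pure_sup_perp_eq_one by blast
  then have "\<not> perp c \<le> m"
    using m spec_less_one by (metis le_sup_iff)
  then show "c \<le> min_below m"
    by (simp add: compact_le_min_below_iff m c)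
qed

text \<open>Primality for products implies primality for meets, as
  \<open>a * b \<le> inf a b\<close>. Conversely, a prime \<open>p\<close> of the frame lies below
  some m-prime \<open>m\<close>, hence below \<open>min_below m\<close>, whose purity yields the
  reverse inequality.\<close>

lemma vir_spec_eq_min_spec:
  assumes pf: "pf_quantale TYPE('a::coherent_quantale)"
  shows "(vir_spec :: 'a set) = min_spec"
proof (intro equalityI subsetI)
  fix p :: 'a
  assume p: "p \<in> min_spec"
  then have s: "p \<in> spec"
    using min_spec_subset by blast
  have "a \<le> p \<or> b \<le> p" if "inf a b \<le> p" for a b
  proof -
    have "a * b \<le> inf a b"
      by (simp add: mult_le_left_quantale mult_le_right_quantale)
    then show ?thesis
      using that spec_mult_le_iff[OF s] order.trans by blast
  qed
  then show "p \<in> vir_spec"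
    using s min_spec_pure[OF pf p] by (simp add: vir_spec_def spec_def)
next
  fix p :: 'a
  assume p: "p \<in> vir_spec"
  then have "\<not> 1 \<le> p" and pure: "p \<in> pure_elements"
    by (auto simp: vir_spec_def)
  then obtain m where m: "m \<in> spec" "p \<le> m"
    using exists_spec_above compact_one by blast
  have pm: "p \<le> min_below m"
    by (rule pure_le_min_below[OF pure m])
  note mm = min_below_in_min_spec[OF pf m(1)]
  have "c \<le> p" if c: "compact_element c" "c \<le> min_below m" for c
  proof -
    have "sup (min_below m) (perp c) = 1"
      using min_spec_pure[OF pf mm] c pure_sup_perp_eq_one by blast
    \<comment> \<open>Compactness of the unit will replace the comaximal pair
      \<open>min_below m\<close>, \<open>perp c\<close> by compact elements below them.\<close>
    then have "1 \<le> Sup {d. compact_element d \<and> (d \<le> min_below m \<or> d \<le> perp c)}"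
      (is "_ \<le> Sup ?D")
    proof -
      have "min_below m \<le> Sup ?D" "perp c \<le> Sup ?D"
        by (subst le_iff_compact_le, auto intro: Sup_upper)+
      then have "sup (min_below m) (perp c) \<le> Sup ?D"
        by simp
      then show ?thesis
        using \<open>sup (min_below m) (perp c) = 1\<close> by simp
    qed
    then obtain F where F: "finite F" "F \<subseteq> ?D" "1 \<le> Sup F"
      by (rule compact_le_SupE[OF compact_one])
    \<comment> \<open>Being compact, \<open>e\<close> and \<open>d\<close> have pure annihilators,
      to which primality of \<open>p\<close> in the frame applies.\<close>
    define e d where "e = Sup {x\<in>F. x \<le> min_below m}" and "d = Sup {x\<in>F. x \<le> perp c}"
    have ce: "compact_element e" "compact_element d"
      unfolding e_def d_def using F by (auto intro!: compact_Sup)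
    have le: "e \<le> min_below m" "d \<le> perp c"
      unfolding e_def d_def by (auto intro!: Sup_least)
    have "Sup F \<le> sup e d"
      unfolding e_def d_def Sup_union_distrib[symmetric]
      by (rule Sup_subset_mono) (use F in auto)
    then have "sup e d = 1"
      using F(3) by (meson antisym le_one_quantale order.trans)
    then have "inf (perp e) (perp d) \<le> p"
      by (simp add: perp_perp_disjoint_of_sup_eq_one)
    then have "perp e \<le> p \<or> perp d \<le> p"
      using p perp_pure[OF pf] ce by (auto simp: vir_spec_def)
    moreover have "\<not> perp e \<le> m"
      using le(1) compact_le_min_below_iff[OF m(1) ce(1)] by simp
    ultimately have "perp d \<le> p"
      using m(2) order.trans by blast
    moreover have "c \<le> perp d"
      using le(2) by (metis le_perp_iff mult.commute)
    ultimately show ?thesis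
      using order.trans by blast
  qed
  then have "min_below m \<le> p"
    by (subst le_iff_compact_le) blast
  then show "p \<in> min_spec"
    using mm pm by (metis antisym)
qed

section \<open>Topological conditions\<close>

lemma pp_sup_perp:
  "pp_quantale TYPE('a::quantale) \<Longrightarrow> compact_element (c::'a) \<Longrightarrow> sup (perp c) (perp (perp c)) = 1"
  by (simp add: pp_quantale_def complemented_elements_def)

text \<open>The product of the two annihilators is \<open>bot\<close>, so one of them lies below
  \<open>p\<close>; their join is the unit, so not both do.\<close>

lemma pp_perp_perp_le_iff:
  fixes p :: "'a::quantale"
  assumes "pp_quantale TYPE('a)" "compact_element c" "p \<in> spec"
  shows "perp c \<le> p \<longleftrightarrow> \<not> perp (perp c) \<le> p"
  by (metis assms le_sup_iff perp_le_spec pp_sup_perp spec_less_one)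

lemma pp_imp_retract:
  assumes pf: "pf_quantale TYPE('a::coherent_quantale)" and pp: "pp_quantale TYPE('a)"
  shows "(min_spec :: 'a set) retract_of_space spec_Z"
proof -
  have "openin spec_Z {p \<in> spec. min_below p \<in> spec_basic a}" for a :: 'a
  proof -
    \<comment> \<open>\<open>a \<le> min_below p\<close> fails iff \<open>perp c \<le> p\<close> for
      some compact \<open>c \<le> a\<close>, that is, iff some \<open>perp (perp c)\<close> is not
      below \<open>p\<close>. So the preimage of \<open>spec_basic a\<close> is
      \<open>spec_basic b\<close>.\<close>
    define b where "b = Sup {perp (perp c) | c. compact_element c \<and> c \<le> a}"
    have "\<not> a \<le> min_below p \<longleftrightarrow> \<not> b \<le> p" if p: "p \<in> spec" for p
    proof -
      have "a \<le> min_below p \<longleftrightarrow> (\<forall>c. compact_element c \<longrightarrow> c \<le> a \<longrightarrow> \<not> perp c \<le> p)"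
        by (subst le_iff_compact_le) (auto simp: compact_le_min_below_iff[OF p])
      also have "\<dots> \<longleftrightarrow> b \<le> p"
        by (auto simp: b_def Sup_le_iff pp_perp_perp_le_iff[OF pp _ p])
      finally show ?thesis by simp
    qed
    then have "{p \<in> spec. min_below p \<in> spec_basic a} = spec_basic b"
      using min_below_in_spec[OF pf] by (auto simp: spec_basic_def)
    then show ?thesis
      by (auto simp: openin_spec_Z)
  qed
  then have "continuous_map spec_Z spec_Z (min_below :: 'a \<Rightarrow> 'a)"
    using min_below_in_spec[OF pf] by (auto simp: continuous_map topspace_spec_Z openin_spec_Z)
  then have "continuous_map spec_Z (subtopology spec_Z min_spec) (min_below :: 'a \<Rightarrow> 'a)"
    using min_below_in_min_spec[OF pf]
    by (auto simp: continuous_map_in_subtopology topspace_spec_Z)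
  then show ?thesis
    unfolding retract_of_space_def
    using min_below_min_spec[OF pf] min_spec_subset by (auto simp: topspace_spec_Z)
qed

text \<open>A cover by sets \<open>spec_basic a\<close> says that the join of these \<open>a\<close>
  is below no m-prime, so it is the unit, and finitely many suffice.\<close>

lemma compact_space_spec_Z: "compact_space (spec_Z :: 'a::coherent_quantale topology)"
  unfolding compact_space_alt topspace_spec_Z
proof (intro allI impI)
  fix \<U> :: "'a set set"
  assume U: "(\<forall>U\<in>\<U>. openin spec_Z U) \<and> spec \<subseteq> \<Union>\<U>"
  define S where "S = {a. spec_basic a \<in> \<U>}"
  have "Sup S = (1::'a)"
  proof (rule eq_one_if_no_spec_above[OF compact_one])
    fix m :: 'a
    assume "m \<in> spec"
    then obtain V where V: "V \<in> \<U>" "m \<in> V" "openin spec_Z V"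
      using U by blast
    then obtain a where "V = spec_basic a"
      by (auto simp: openin_spec_Z)
    then have "a \<in> S" "\<not> a \<le> m"
      using V by (simp_all add: S_def spec_basic_def)
    then show "\<not> Sup S \<le> m"
      using Sup_upper order.trans by blast
  qed
  then obtain F where F: "finite F" "F \<subseteq> S" "1 \<le> Sup F"
    by (metis compact_le_SupE[OF compact_one] order_refl)
  have "spec \<subseteq> (\<Union>a\<in>F. spec_basic a)"
  proof
    fix p :: 'a
    assume p: "p \<in> spec"
    then have "\<not> Sup F \<le> p"
      using F(3) spec_less_one order.trans by blast
    then show "p \<in> (\<Union>a\<in>F. spec_basic a)"
      using p by (auto simp: Sup_le_iff spec_basic_def)
  qed
  then show "\<exists>\<F>. finite \<F> \<and> \<F> \<subseteq> \<U> \<and> spec \<subseteq> \<Union>\<F>"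
    using F by (intro exI[of _ "spec_basic ` F"]) (auto simp: S_def)
qed

text \<open>The retraction makes \<open>S\<close> a continuous image of \<open>X\<close>.\<close>

lemma retract_imp_compact_space:
  assumes "S retract_of_space X" "compact_space X"
  shows "compact_space (subtopology X S)"
proof -
  obtain r where r: "S \<subseteq> topspace X" "continuous_map X (subtopology X S) r" "\<forall>x\<in>S. r x = x"
    using assms(1) by (auto simp: retract_of_space_def)
  have "r ` topspace X = S"
    using r by (force simp: continuous_map_in_subtopology)
  then have "compactin (subtopology X S) S"
    using image_compactin[OF _ r(2)] assms(2) by (metis compact_space_def)
  then show ?thesis
    using compactin_subtopology compact_space_subtopology by metis
qed

section \<open>Compactness of the minimal spectrum and openness in the frame of pure
  elements\<close>

lemma openin_min_Z:
  fixes U :: "'a::quantale set"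
  shows "openin min_Z U \<longleftrightarrow> (\<exists>a. U = {p \<in> min_spec. \<not> a \<le> p})"
proof -
  have "spec_basic a \<inter> min_spec = {p \<in> min_spec. \<not> a \<le> p}" for a :: 'a
    using min_spec_subset by (auto simp: spec_basic_def)
  then show ?thesis
    unfolding min_Z_def openin_subtopology openin_spec_Z by metis
qed

lemma topspace_min_Z: "topspace min_Z = min_spec"
  using min_spec_subset by (auto simp: min_Z_def topspace_spec_Z)

lemma compact_min_imp_pp:
  assumes pf: "pf_quantale TYPE('a::coherent_quantale)" and cpt: "compact_space (min_Z :: 'a topology)"
  shows "pp_quantale TYPE('a)"
  unfolding pp_quantale_def complemented_elements_def
proof (intro allI impI CollectI)
  fix c :: 'a
  assume c: "compact_element c"
  have "min_spec - {p \<in> min_spec. c \<le> p} = {p \<in> min_spec. \<not> c \<le> p}"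
    by blast
  then have "closedin min_Z {p \<in> min_spec. c \<le> p}"
    by (auto simp: closedin_def topspace_min_Z openin_min_Z)
  then have K: "compactin min_Z {p \<in> min_spec. c \<le> p}"
    using cpt closedin_compact_space by blast
  \<comment> \<open>A minimal prime above \<open>c\<close> is not above \<open>perp c\<close>, hence
    not above some compact \<open>d \<le> perp c\<close>; these sets cover.\<close>
  define \<U> where "\<U> = (\<lambda>d. {p \<in> min_spec. \<not> d \<le> p}) ` {d. compact_element d \<and> d \<le> perp c}"
  have "{p \<in> min_spec. c \<le> p} \<subseteq> \<Union>\<U>"
  proof
    fix p
    assume p: "p \<in> {p \<in> min_spec. c \<le> p}"
    then have "\<not> perp c \<le> p"
      using min_spec_compact_le_iff[OF pf _ c] by blast
    then obtain d where "compact_element d" "d \<le> perp c" "\<not> d \<le> p"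
      by (rule not_le_compact)
    then show "p \<in> \<Union>\<U>"
      using p by (auto simp: \<U>_def)
  qed
  moreover have "\<forall>U\<in>\<U>. openin min_Z U"
    by (auto simp: \<U>_def openin_min_Z)
  ultimately obtain \<F> where "finite \<F>" "\<F> \<subseteq> \<U>" and cover: "{p \<in> min_spec. c \<le> p} \<subseteq> \<Union>\<F>"
    using K unfolding compactin_def by meson
  then obtain F where F: "finite F" "F \<subseteq> {d. compact_element d \<and> d \<le> perp c}"
    and FF: "\<F> = (\<lambda>d. {p \<in> min_spec. \<not> d \<le> p}) ` F"
    unfolding \<U>_def by (meson finite_subset_image)
  define d where "d = Sup F"
  have d: "compact_element d" "d \<le> perp c"
    unfolding d_def using F by (auto intro!: compact_Sup Sup_least)
  \<comment> \<open>By the finite subcover no minimal prime is above both \<open>c\<close> and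
    \<open>d\<close>, so each is above \<open>perp c\<close> or \<open>perp d\<close>.\<close>
  have "perp c * perp d = bot"
  proof (rule bot_if_le_min_spec[OF pf])
    fix p :: 'a
    assume p: "p \<in> min_spec"
    then have s: "p \<in> spec"
      using min_spec_subset by blast
    have "\<not> c \<le> p \<or> \<not> d \<le> p"
      using cover p by (auto simp: FF d_def Sup_le_iff)
    then show "perp c * perp d \<le> p"
      using perp_le_spec[OF s] spec_mult_le_iff[OF s] by blast
  qed
  then have "perp d \<le> perp (perp c)"
    by (simp add: le_perp_iff)
  moreover have "sup (perp c) (perp d) = 1"
    using perp_pure[OF pf c] d pure_sup_perp_eq_one by blast
  ultimately have "1 \<le> sup (perp c) (perp (perp c))"
    by (metis order_refl sup.mono)
  then show "sup (perp c) (perp (perp c)) = 1"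
    by (simp add: antisym le_one_quantale)
qed

text \<open>If \<open>perp c\<close> is complemented, so is \<open>perp (perp c)\<close>; it is then
  pure and cuts out the same minimal primes as \<open>c\<close>.\<close>

lemma pp_iff_open_in_vir_spec:
  assumes pf: "pf_quantale TYPE('a::coherent_quantale)"
  shows "pp_quantale TYPE('a) \<longleftrightarrow>
    (\<forall>c::'a. compact_element c \<longrightarrow> openin vir_spec_Z (min_spec \<inter> spec_basic c))"
proof (intro iffI allI impI)
  fix c :: 'a
  assume pp: "pp_quantale TYPE('a)" and c: "compact_element c"
  have "sup (perp (perp c)) (perp c) = 1" "perp (perp c) * perp c = bot"
    using pp_sup_perp[OF pp c] perp_mult[of "perp c"] by (simp_all add: sup_commute mult.commute)
  then have "perp (perp c) \<in> pure_elements"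
    by (rule complemented_pure)
  moreover have "min_spec \<inter> spec_basic c = {p \<in> vir_spec. \<not> perp (perp c) \<le> p}"
    using pp_perp_perp_le_iff[OF pp c] min_spec_compact_le_iff[OF pf _ c] min_spec_subset
    by (auto simp: vir_spec_eq_min_spec[OF pf] spec_basic_def)
  ultimately show "openin vir_spec_Z (min_spec \<inter> spec_basic c)"
    by (auto simp: openin_vir_spec_Z)
next
  assume R: "\<forall>c::'a. compact_element c \<longrightarrow> openin vir_spec_Z (min_spec \<inter> spec_basic c)"
  show "pp_quantale TYPE('a)"
    unfolding pp_quantale_def complemented_elements_def
  proof (intro allI impI CollectI)
    fix c :: 'a
    assume c: "compact_element c"
    then obtain a where a: "a \<in> pure_elements"
      and eq: "min_spec \<inter> spec_basic c = {p \<in> vir_spec. \<not> a \<le> p}"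
      using R by (auto simp: openin_vir_spec_Z)
    have iff: "c \<le> p \<longleftrightarrow> a \<le> p" if "p \<in> min_spec" for p
      using eq that min_spec_subset by (auto simp: vir_spec_eq_min_spec[OF pf] spec_basic_def set_eq_iff)
    have "sup (perp c) a = 1"
    proof (rule eq_one_if_no_spec_above[OF compact_one])
      fix m :: 'a
      assume m: "m \<in> spec"
      show "\<not> sup (perp c) a \<le> m"
      proof
        assume *: "sup (perp c) a \<le> m"
        \<comment> \<open>Purity lets \<open>a\<close> descend from \<open>m\<close> to a minimal
          prime, where it can be exchanged for \<open>c\<close>.\<close>
        then have "a \<le> min_below m"
          using pure_le_min_below[OF a m] by simp
        then have "c \<le> min_below m"
          using iff[OF min_below_in_min_spec[OF pf m]] by simp
        then show False
          using * by (simp add: compact_le_min_below_iff m c)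
      qed
    qed
    moreover have "perp c * a = bot"
    proof (rule bot_if_le_min_spec[OF pf])
      fix p :: 'a
      assume p: "p \<in> min_spec"
      then have s: "p \<in> spec"
        using min_spec_subset by blast
      show "perp c * a \<le> p"
        using iff[OF p] perp_le_spec[OF s] spec_mult_le_iff[OF s] by blast
    qed
    then have "a \<le> perp (perp c)"
      by (simp add: le_perp_iff)
    ultimately have "1 \<le> sup (perp c) (perp (perp c))"
      by (metis order_refl sup.mono)
    then show "sup (perp c) (perp (perp c)) = 1"
      by (simp add: antisym le_one_quantale)
  qed
qed

section \<open>Transfer to the reticulation\<close>

text \<open>The retraction \<open>r\<close> is conjugated to
  \<open>f \<circ> (r \<circ> g)\<close>.\<close>

lemma homeomorphic_maps_retract_of_space:
  assumes fg: "homeomorphic_maps X Y f g" and S: "S retract_of_space X"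
  shows "f ` S retract_of_space Y"
proof -
  obtain r where r: "S \<subseteq> topspace X" "continuous_map X (subtopology X S) r" "\<forall>x\<in>S. r x = x"
    using S by (auto simp: retract_of_space_def)
  have f: "continuous_map X Y f" and g: "continuous_map Y X g" and gf: "\<And>x. x \<in> topspace X \<Longrightarrow> g (f x) = x"
    using fg by (auto simp: homeomorphic_maps_def)
  have r': "continuous_map X X r" "r \<in> topspace X \<rightarrow> S"
    using r(2) by (auto simp: continuous_map_in_subtopology)
  have "continuous_map Y Y (f \<circ> (r \<circ> g))"
    using f g r'(1) by (blast intro: continuous_map_compose)
  moreover have "f \<circ> (r \<circ> g) \<in> topspace Y \<rightarrow> f ` S"
    using r'(2) continuous_map_funspace[OF g] by (auto simp: Pi_iff)
  ultimately have "continuous_map Y (subtopology Y (f ` S)) (f \<circ> (r \<circ> g))"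
    by (simp add: continuous_map_in_subtopology)
  moreover have "f ` S \<subseteq> topspace Y"
    using f r(1) by (auto simp: continuous_map)
  moreover have "(f \<circ> (r \<circ> g)) y = y" if "y \<in> f ` S" for y
    using that gf r(1,3) by auto
  ultimately show ?thesis
    unfolding retract_of_space_def by blast
qed

lemma homeomorphic_map_retract_of_space_iff:
  assumes f: "homeomorphic_map X Y f" and S: "S \<subseteq> topspace X"
  shows "f ` S retract_of_space Y \<longleftrightarrow> S retract_of_space X"
proof -
  obtain g where g: "homeomorphic_maps X Y f g"
    using f homeomorphic_map_maps by blast
  have "g ` f ` S = S"
    using g S by (force simp: homeomorphic_maps_def image_image)
  then show ?thesis
    using homeomorphic_maps_retract_of_space g homeomorphic_maps_sym by metis
qed

section \<open>The space of prime ideals of a lattice\<close>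

lemma openin_spec_Id_Z_basic: "openin spec_Id_Z {P \<in> prime_ideals. x \<notin> P}"
  unfolding openin_spec_Id_Z by (rule arbitrary_union_of_inc) blast

lemma topspace_spec_Id_Z: "topspace (spec_Id_Z :: 'l::{distrib_lattice,bounded_lattice} set topology) = prime_ideals"
proof
  have "top \<notin> P" if "P \<in> prime_ideals" for P :: "'l set"
    using that unfolding prime_ideals_def lattice_ideal_def by (auto simp: set_eq_iff)
  then have "prime_ideals = {P \<in> prime_ideals. (top::'l) \<notin> P}"
    by blast
  then have "openin spec_Id_Z (prime_ideals :: 'l set set)"
    by (metis openin_spec_Id_Z_basic)
  then show "prime_ideals \<subseteq> topspace (spec_Id_Z :: 'l set topology)"
    by (rule openin_subset)
  show "topspace (spec_Id_Z :: 'l set topology) \<subseteq> prime_ideals"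
    using openin_topspace[of "spec_Id_Z :: 'l set topology"]
    unfolding openin_spec_Id_Z by (auto simp: union_of_def)
qed

section \<open>The reticulation map on compact elements\<close>

context
  fixes lam :: "'a::coherent_quantale \<Rightarrow> 'l::{distrib_lattice,bounded_lattice}"
  assumes lam: "is_reticulation lam"
begin

lemma lam_le_iff: "compact_element a \<Longrightarrow> compact_element b \<Longrightarrow> lam a \<le> lam b \<longleftrightarrow> (\<exists>n\<ge>1. a ^ n \<le> b)"
  using lam by (simp add: is_reticulation_def)

lemma lam_mult: "compact_element a \<Longrightarrow> compact_element b \<Longrightarrow> lam (a * b) = inf (lam a) (lam b)"
  using lam by (simp add: is_reticulation_def)

lemma lam_mono: "compact_element a \<Longrightarrow> compact_element b \<Longrightarrow> a \<le> b \<Longrightarrow> lam a \<le> lam b"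
  by (subst lam_le_iff) (auto intro!: exI[of _ 1])

text \<open>One inequality is an axiom of reticulations, the other is monotonicity.\<close>

lemma lam_sup:
  assumes "compact_element a" "compact_element b"
  shows "lam (sup a b) = sup (lam a) (lam b)"
  using assms lam by (intro antisym) (auto simp: is_reticulation_def intro!: lam_mono compact_sup)

lemma lam_cases: obtains c where "compact_element c" "x = lam c"
  using lam unfolding is_reticulation_def by (metis (mono_tags, lifting) UNIV_I imageE mem_Collect_eq)

lemma lam_bot: "lam bot = bot"
proof -
  obtain c where "compact_element c" "bot = lam c"
    by (rule lam_cases)
  then show ?thesis
    by (metis bot_least bot_unique compact_bot lam_mono)
qed

lemma lam_one: "lam 1 = top"
proof -
  obtain c where "compact_element c" "top = lam c"
    by (rule lam_cases)
  then show ?thesis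
    by (metis compact_one lam_mono le_one_quantale top_unique)
qed

text \<open>\<open>lam c = bot\<close> says only that a power of \<open>c\<close> vanishes; the PF
  condition excludes nonzero nilpotent compact elements.\<close>

lemma lam_eq_bot_iff:
  assumes "pf_quantale TYPE('a)" "compact_element c"
  shows "lam c = bot \<longleftrightarrow> c = bot"
proof
  assume "lam c = bot"
  then obtain n where "c ^ n \<le> bot"
    using lam_le_iff[OF assms(2) compact_bot] by (auto simp: lam_bot)
  then show "c = bot"
    using pf_semiprime[OF assms] bot_unique by blast
qed (simp add: lam_bot)

lemma lam_eq_top_iff:
  assumes "compact_element c"
  shows "lam c = top \<longleftrightarrow> c = 1"
proof
  assume "lam c = top"
  then show "c = 1"
    using lam_le_iff[OF compact_one assms] by (auto simp: lam_one intro: antisym le_one_quantale)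
qed (simp add: lam_one)

lemma lam_inf_eq_bot_iff:
  assumes "pf_quantale TYPE('a)" "compact_element c" "compact_element d"
  shows "inf (lam c) (lam d) = bot \<longleftrightarrow> c * d = bot"
  using assms by (simp add: lam_mult[symmetric] lam_eq_bot_iff compact_mult)

text \<open>A complemented \<open>perp c\<close> is compact, and its image generates the annihilator
  of \<open>lam c\<close>. Conversely, a complemented generator \<open>e\<close> of that annihilator
  and its complement \<open>f\<close> lift to complementary \<open>d\<close> and \<open>g\<close>
  with \<open>d \<le> perp c\<close> and \<open>g \<le> perp (perp c)\<close>.\<close>

lemma pp_iff_stone:
  assumes pf: "pf_quantale TYPE('a)"
  shows "pp_quantale TYPE('a) \<longleftrightarrow> stone_lattice TYPE('l)"
proof
  assume pp: "pp_quantale TYPE('a)"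
  show "stone_lattice TYPE('l)"
    unfolding stone_lattice_def
  proof
    fix x :: 'l
    obtain c where c: "compact_element c" and x: "x = lam c"
      by (rule lam_cases)
    let ?e = "perp c" and ?f = "perp (perp c)"
    have ef: "sup ?e ?f = 1" "?e * ?f = bot"
      using pp_sup_perp[OF pp c] perp_mult by auto
    have cef: "compact_element ?e" "compact_element ?f"
      using ef complemented_compact[OF compact_one] by (metis sup_commute mult.commute)+
    have "inf x y = bot \<longleftrightarrow> y \<le> lam ?e" for y
    proof -
      obtain d where d: "compact_element d" and y: "y = lam d"
        by (rule lam_cases)
      \<comment> \<open>\<open>lam d \<le> lam ?e\<close> puts only a power of \<open>d\<close>
        below \<open>perp c\<close>; the absence of nilpotents removes the exponent.\<close>
      have "c * d = bot" if "c * d ^ n = bot" "n \<ge> 1" for n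
      proof -
        have "c ^ n \<le> c"
          using that(2) by (cases n) (simp_all add: mult_le_left_quantale)
        then have "(c * d) ^ n \<le> c * d ^ n"
          unfolding power_mult_distrib by (rule mult_mono2_quantale) simp
        then show ?thesis
          using that(1) pf_semiprime[OF pf compact_mult[OF c d]] by (simp add: bot_unique)
      qed
      moreover have "y \<le> lam ?e \<longleftrightarrow> (\<exists>n\<ge>1. c * d ^ n = bot)"
        by (simp add: y lam_le_iff d cef le_perp_iff)
      moreover have "inf x y = bot \<longleftrightarrow> c * d ^ 1 = bot"
        by (simp add: x y lam_inf_eq_bot_iff[OF pf c d])
      ultimately show ?thesis
        by (metis order_refl power_one_right)
    qed
    moreover have "sup (lam ?e) (lam ?f) = top" "inf (lam ?e) (lam ?f) = bot"
      using cef ef by (simp_all add: lam_sup[symmetric] lam_mult[symmetric] lam_one lam_bot)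
    ultimately show "\<exists>e. (\<exists>f. sup e f = top \<and> inf e f = bot) \<and> {y. inf x y = bot} = {y. y \<le> e}"
      by blast
  qed
next
  assume st: "stone_lattice TYPE('l)"
  show "pp_quantale TYPE('a)"
    unfolding pp_quantale_def complemented_elements_def
  proof (intro allI impI CollectI)
    fix c :: 'a
    assume c: "compact_element c"
    obtain e f where ef: "sup e f = top" "inf e f = bot" "{y. inf (lam c) y = bot} = {y. y \<le> e}"
      using st unfolding stone_lattice_def by blast
    obtain d where d: "compact_element d" "e = lam d"
      by (rule lam_cases)
    obtain g where g: "compact_element g" "f = lam g"
      by (rule lam_cases)
    \<comment> \<open>Complements lift because \<open>lam\<close> reflects both the unit and
      \<open>bot\<close>.\<close>
    have dg: "sup d g = 1" "d * g = bot"
      using ef d g lam_eq_top_iff[of "sup d g"] lam_inf_eq_bot_iff[OF pf, of d g]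
      by (simp_all add: lam_sup compact_sup)
    have "d \<le> perp c"
      using ef(3) lam_inf_eq_bot_iff[OF pf c d(1)] by (auto simp: le_perp_iff d(2))
    moreover have "perp c \<le> perp g"
    proof (subst le_iff_compact_le, intro allI impI)
      fix h
      assume h: "compact_element h" "h \<le> perp c"
      then have "lam h \<le> lam d"
        using ef(3) lam_inf_eq_bot_iff[OF pf c h(1)] by (auto simp: le_perp_iff d(2))
      then have "inf (lam h) (lam g) \<le> inf (lam d) (lam g)"
        by (rule inf_mono) simp
      then have "inf (lam g) (lam h) = bot"
        using ef(2) by (metis bot_unique d(2) g(2) inf_commute)
      then show "h \<le> perp g"
        using lam_inf_eq_bot_iff[OF pf g(1) h(1)] by (simp add: le_perp_iff)
    qed
    then have "g \<le> perp (perp c)"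
      by (metis le_perp_iff mult.commute)
    ultimately have "1 \<le> sup (perp c) (perp (perp c))"
      by (metis dg(1) sup.mono)
    then show "sup (perp c) (perp (perp c)) = 1"
      by (simp add: antisym le_one_quantale)
  qed
qed

section \<open>The homeomorphism from m-prime elements to prime ideals\<close>

definition spec_to_ideal :: "'a \<Rightarrow> 'l set" where
  "spec_to_ideal p = lam ` {c. compact_element c \<and> c \<le> p}"

text \<open>Equal values \<open>lam c = lam d\<close> give only a power of \<open>c\<close> below
  \<open>d\<close>, which suffices because \<open>p\<close> is prime.\<close>

lemma lam_in_spec_to_ideal_iff:
  assumes p: "p \<in> spec" and c: "compact_element c"
  shows "lam c \<in> spec_to_ideal p \<longleftrightarrow> c \<le> p"
proof
  assume "lam c \<in> spec_to_ideal p"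
  then obtain d where d: "compact_element d" "d \<le> p" "lam c = lam d"
    by (auto simp: spec_to_ideal_def)
  then obtain n where "c ^ n \<le> d"
    using lam_le_iff[OF c d(1)] by auto
  then show "c \<le> p"
    using d spec_power_le[OF p] order.trans by blast
qed (use c in \<open>auto simp: spec_to_ideal_def\<close>)

lemma spec_to_ideal_subset_iff:
  assumes "p \<in> spec" "q \<in> spec"
  shows "spec_to_ideal p \<subseteq> spec_to_ideal q \<longleftrightarrow> p \<le> q"
proof -
  have "spec_to_ideal p \<subseteq> spec_to_ideal q \<longleftrightarrow>
      (\<forall>c. compact_element c \<longrightarrow> c \<le> p \<longrightarrow> lam c \<in> spec_to_ideal q)"
    by (auto simp: spec_to_ideal_def[of p])
  then show ?thesis
    using assms by (simp add: lam_in_spec_to_ideal_iff le_iff_compact_le[of p])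
qed

lemma spec_to_ideal_prime:
  assumes p: "p \<in> spec"
  shows "spec_to_ideal p \<in> prime_ideals"
  unfolding prime_ideals_def lattice_ideal_def
proof (intro CollectI conjI ballI allI impI)
  show "bot \<in> spec_to_ideal p"
    using lam_in_spec_to_ideal_iff[OF p compact_bot] by (simp add: lam_bot)
  show "spec_to_ideal p \<noteq> UNIV"
    using lam_in_spec_to_ideal_iff[OF p compact_one] spec_less_one[OF p] by auto
  fix x y
  obtain c where c: "compact_element c" "x = lam c" by (rule lam_cases)
  obtain d where d: "compact_element d" "y = lam d" by (rule lam_cases)
  note [simp] = c d lam_sup[symmetric] lam_mult[symmetric] compact_sup compact_mult
    lam_in_spec_to_ideal_iff[OF p] spec_mult_le_iff[OF p]
  show "inf x y \<in> spec_to_ideal p \<Longrightarrow> x \<in> spec_to_ideal p \<or> y \<in> spec_to_ideal p"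
    by simp
  assume x: "x \<in> spec_to_ideal p"
  show "y \<in> spec_to_ideal p \<Longrightarrow> sup x y \<in> spec_to_ideal p"
    using x by simp
  show "y \<in> spec_to_ideal p" if "y \<le> x"
  proof -
    obtain n where "d ^ n \<le> c"
      using \<open>y \<le> x\<close> lam_le_iff[OF d(1) c(1)] by auto
    then have "d \<le> p"
      using x spec_power_le[OF p] order.trans[of "d ^ n" c p] by simp
    then show ?thesis by simp
  qed
qed

text \<open>The inverse sends \<open>P\<close> to the join \<open>p\<close> of the compact
  \<open>c\<close> with \<open>lam c \<in> P\<close>. These \<open>c\<close> are closed under finite
  joins, so by compactness no further compact element lies below \<open>p\<close>.\<close>

lemma spec_to_ideal_image: "spec_to_ideal ` spec = prime_ideals"
proof (intro equalityI subsetI)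
  fix P :: "'l set"
  assume P: "P \<in> prime_ideals"
  then have bot: "bot \<in> P" and sup: "\<And>x y. x \<in> P \<Longrightarrow> y \<in> P \<Longrightarrow> sup x y \<in> P"
    and down: "\<And>x y. x \<in> P \<Longrightarrow> y \<le> x \<Longrightarrow> y \<in> P" and proper: "P \<noteq> UNIV"
    and prime: "\<And>x y. inf x y \<in> P \<Longrightarrow> x \<in> P \<or> y \<in> P"
    by (auto simp: prime_ideals_def lattice_ideal_def)
  define p where "p = Sup {c. compact_element c \<and> lam c \<in> P}"
  have le: "c \<le> p \<longleftrightarrow> lam c \<in> P" if c: "compact_element c" for c
  proof
    assume "c \<le> p"
    then obtain F where F: "finite F" "F \<subseteq> {c. compact_element c \<and> lam c \<in> P}" "c \<le> Sup F"
      unfolding p_def by (rule compact_le_SupE[OF c])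
    have "compact_element (Sup F) \<and> lam (Sup F) \<in> P"
      using F(1,2) by (induction F) (auto simp: lam_bot bot compact_bot compact_sup lam_sup sup)
    then show "lam c \<in> P"
      using down lam_mono[OF c _ F(3)] by blast
  qed (auto simp: p_def c intro: Sup_upper)
  have "p \<in> spec"
  proof (rule spec_compactI)
    have "top \<notin> P"
      using proper down[of top] by auto
    then show "\<not> 1 \<le> p"
      by (simp add: le compact_one lam_one)
    show "a \<le> p \<or> b \<le> p" if "compact_element a" "compact_element b" "a * b \<le> p" for a b
      using that prime by (simp add: le compact_mult lam_mult)
  qed
  moreover have "spec_to_ideal p = P"
  proof -
    have "x \<in> spec_to_ideal p \<longleftrightarrow> x \<in> P" for x
    proof -
      obtain c where "compact_element c" "x = lam c" by (rule lam_cases)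
      then show ?thesis
        by (simp add: lam_in_spec_to_ideal_iff[OF \<open>p \<in> spec\<close>] le)
    qed
    then show ?thesis by blast
  qed
  ultimately show "P \<in> spec_to_ideal ` spec"
    by blast
qed (auto intro: spec_to_ideal_prime)

text \<open>An order isomorphism preserves minimal elements.\<close>

lemma spec_to_ideal_image_min: "spec_to_ideal ` min_spec = min_prime_ideals"
proof -
  have eq: "spec_to_ideal q = spec_to_ideal p \<longleftrightarrow> q = p" if "p \<in> spec" "q \<in> spec" for p q
    using that spec_to_ideal_subset_iff by (metis antisym order_refl)
  have "spec_to_ideal p \<in> min_prime_ideals \<longleftrightarrow> p \<in> min_spec" if p: "p \<in> spec" for p
    using p by (simp add: min_prime_ideals_def min_spec_def spec_to_ideal_image[symmetric]
        spec_to_ideal_subset_iff eq)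
  moreover have "min_prime_ideals \<subseteq> spec_to_ideal ` spec"
    by (auto simp: spec_to_ideal_image min_prime_ideals_def)
  ultimately show ?thesis
    using min_spec_subset by blast
qed

lemma spec_to_ideal_basic:
  assumes c: "compact_element c"
  shows "spec_to_ideal ` spec_basic c = {P \<in> prime_ideals. lam c \<notin> P}"
  using lam_in_spec_to_ideal_iff[OF _ c]
  by (auto simp: spec_to_ideal_image[symmetric] spec_basic_def)

text \<open>The sets \<open>spec_basic c\<close> with \<open>c\<close> compact form a base, since
  every \<open>a\<close> is a join of compact elements, and they correspond to the basic open sets
  of prime ideals.\<close>

lemma homeomorphic_map_spec_to_ideal: "homeomorphic_map spec_Z spec_Id_Z spec_to_ideal"
proof (rule bijective_open_imp_homeomorphic_map)
  show "spec_to_ideal ` topspace spec_Z = topspace spec_Id_Z"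
    by (simp add: topspace_spec_Z topspace_spec_Id_Z spec_to_ideal_image)
  show "inj_on spec_to_ideal (topspace spec_Z)"
    unfolding topspace_spec_Z by (metis (no_types, lifting) antisym inj_onI order_refl spec_to_ideal_subset_iff)
  show "open_map spec_Z spec_Id_Z spec_to_ideal"
    unfolding open_map_def openin_spec_Z
  proof (intro allI impI, elim exE)
    fix U and a :: 'a
    assume U: "U = spec_basic a"
    obtain C where C: "\<forall>c\<in>C. compact_element c" "a = Sup C"
      using algebraic by blast
    have "spec_to_ideal ` U = (\<Union>c\<in>C. {P \<in> prime_ideals. lam c \<notin> P})"
      using C(1) by (simp add: U C(2) spec_basic_Sup image_UN spec_to_ideal_basic)
    then show "openin spec_Id_Z (spec_to_ideal ` U)"
      by (auto simp: openin_spec_Id_Z_basic)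
  qed
  show "continuous_map spec_Z spec_Id_Z spec_to_ideal"
    unfolding continuous_map topspace_spec_Z topspace_spec_Id_Z
  proof (intro conjI allI impI)
    show "spec_to_ideal ` spec \<subseteq> prime_ideals"
      by (simp add: spec_to_ideal_image)
    fix U :: "'l set set"
    assume "openin spec_Id_Z U"
    then obtain \<B> where B: "\<And>V. V \<in> \<B> \<Longrightarrow> \<exists>x. V = {P \<in> prime_ideals. x \<notin> P}" "U = \<Union>\<B>"
      unfolding openin_spec_Id_Z by (auto simp: union_of_def)
    have "openin spec_Z {p \<in> spec. spec_to_ideal p \<in> V}" if "V \<in> \<B>" for V
    proof -
      obtain x where x: "V = {P \<in> prime_ideals. x \<notin> P}"
        using B(1)[OF \<open>V \<in> \<B>\<close>] by blast
      obtain c where c: "compact_element c" "x = lam c"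
        by (rule lam_cases)
      have "{p \<in> spec. spec_to_ideal p \<in> V} = spec_basic c"
        using spec_to_ideal_prime by (auto simp: x c lam_in_spec_to_ideal_iff spec_basic_def)
      then show ?thesis
        by (auto simp: openin_spec_Z)
    qed
    then have "openin spec_Z (\<Union>V\<in>\<B>. {p \<in> spec. spec_to_ideal p \<in> V})"
      by blast
    moreover have "(\<Union>V\<in>\<B>. {p \<in> spec. spec_to_ideal p \<in> V}) = {p \<in> spec. spec_to_ideal p \<in> U}"
      using B(2) by blast
    ultimately show "openin spec_Z {p \<in> spec. spec_to_ideal p \<in> U}"
      by simp
  qed
qed

end

theorem theorem8p7:
  fixes lam :: "'a::coherent_quantale \<Rightarrow> 'l::{distrib_lattice,bounded_lattice}"
  assumes "pf_quantale TYPE('a)"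
    and "is_reticulation lam"
  shows "(pp_quantale TYPE('a) \<longleftrightarrow> stone_lattice TYPE('l)) \<and>
    (pp_quantale TYPE('a) \<longleftrightarrow> (min_prime_ideals :: 'l set set) retract_of_space spec_Id_Z) \<and>
    (pp_quantale TYPE('a) \<longleftrightarrow> (min_spec :: 'a set) retract_of_space spec_Z) \<and>
    (pp_quantale TYPE('a) \<longleftrightarrow>
       (\<forall>c::'a. compact_element c \<longrightarrow> openin vir_spec_Z (min_spec \<inter> spec_basic c))) \<and>
    (pp_quantale TYPE('a) \<longleftrightarrow> compact_space (min_Z :: 'a topology))"
proof -
  have compact: "compact_space (min_Z :: 'a topology)" if "(min_spec :: 'a set) retract_of_space spec_Z"
    using retract_imp_compact_space[OF that compact_space_spec_Z] by (simp add: min_Z_def)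
  have retract: "(min_prime_ideals :: 'l set set) retract_of_space spec_Id_Z \<longleftrightarrow>
      (min_spec :: 'a set) retract_of_space spec_Z"
    unfolding spec_to_ideal_image_min[OF assms(2), symmetric]
    by (rule homeomorphic_map_retract_of_space_iff[OF homeomorphic_map_spec_to_ideal[OF assms(2)]])
      (simp add: topspace_spec_Z min_spec_subset)
  \<comment> \<open>The PP condition gives the retraction of \<open>spec_Z\<close>, this gives
    compactness, and compactness gives PP again; the other three conditions attach by
    equivalences.\<close>
  show ?thesis
    using pp_iff_stone[OF assms(2,1)] pp_iff_open_in_vir_spec[OF assms(1)] pp_imp_retract[OF assms(1)]
      compact_min_imp_pp[OF assms(1)] compact retract
    by blast
qed

end
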